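(* Let $\Gamma=(V,E)$ be an unbalanced distance-biregular graph with diameter $d=2r+2$ and girth deficiency two, with parameters $k,l$. Let the polynomials $F_i(X)\in\mathbb Z[X]$ be defined by $F_0(X)=1$, $F_1(X)=X+k$, $F_{i+2}(X)=XF_{i+1}(X)-kl\,F_i(X)$ for $i\ge0$. Then every irreducible factor of $F_r(X)$ over the integers has degree at most two.
   Context: All graphs are finite, undirected and simple. For a connected graph $\Gamma$ and a vertex $u$, $\Gamma_i(u)$ is the set of vertices at distance $i$ from $u$, and $\varepsilon(u)$ is the eccentricity of $u$. A connected bipartite graph with bipartition classes $A$, $B$ is distance-biregular if, for every vertex $u$, every $0\le i\le\varepsilon(u)$ and every $v\in\Gamma_i(u)$, the numbers $|\Gamma_{i+1}(u)\cap\Gamma_1(v)|$ and $|\Gamma_{i-1}(u)\cap\Gamma_1(v)|$ depend only on $i$ and on the class containing $u$. All vertices of $A$ (resp. $B$) then have the same eccentricity $d_A$ (resp. $d_B$). The graph is unbalanced if $d_A\ne d_B$; it has girth deficiency two if its girth is $2d-2$, where $d$ is the diameter. In the unbalanced case the classes are labelled so that $d=d_A>d_B$; it is known that then $d$ is even, and we write $d=2r+2$ ($r\ge1$). The degree of the vertices of $A$ is $k+1$ and the degree of the vertices of $B$ is $l+1$. *)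

theory Defs
  imports
    "Graph_Theory.Digraph_Component"
    "HOL-Library.Extended_Nat"
    "HOL-Computational_Algebra.Polynomial_Factorial"
begin

text \<open>
  A finite undirected simple graph is a digraph satisfying the locale predicate \<^const>\<open>graph\<close>
  (finite, loop-free, no parallel arcs, symmetric): every edge is a pair of opposite arcs.
\<close>

text \<open>Meaningful only if some walk from \<open>u\<close> to \<open>v\<close> exists, so only used for connected graphs.\<close>

definition gdist :: "('a, 'b) pre_digraph \<Rightarrow> 'a \<Rightarrow> 'a \<Rightarrow> nat" where
  "gdist G u v = (LEAST n. \<exists>p. pre_digraph.awalk G u p v \<and> length p = n)"

definition dist_layer :: "('a, 'b) pre_digraph \<Rightarrow> nat \<Rightarrow> 'a \<Rightarrow> 'a set" where
  "dist_layer G i u = {v \<in> verts G. gdist G u v = i}"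

definition ecc :: "('a, 'b) pre_digraph \<Rightarrow> 'a \<Rightarrow> nat" where
  "ecc G u = Max (gdist G u ` verts G)"

definition diameter :: "('a, 'b) pre_digraph \<Rightarrow> nat" where
  "diameter G = Max (ecc G ` verts G)"

text \<open>
  The bound on the length excludes the closed walks that traverse one edge back and forth, which
  the digraph notion of a cycle admits. The girth of a forest is \<open>\<infinity>\<close>.
\<close>

definition girth :: "('a, 'b) pre_digraph \<Rightarrow> enat" where
  "girth G = (INF p \<in> {p. pre_digraph.cycle G p \<and> 3 \<le> length p}. enat (length p))"

definition bipartition :: "('a, 'b) pre_digraph \<Rightarrow> 'a set \<Rightarrow> 'a set \<Rightarrow> bool" where
  "bipartition G A B \<longleftrightarrow> A \<union> B = verts G \<and> A \<inter> B = {} \<and>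
     (\<forall>u v. u \<rightarrow>\<^bsub>G\<^esub> v \<longrightarrow> (u \<in> A \<and> v \<in> B) \<or> (u \<in> B \<and> v \<in> A))"

text \<open>
  For \<open>i = 0\<close> the layer with index \<open>i - 1\<close> should be empty; with truncated subtraction the
  intersection is that of \<open>{u}\<close> with the neighbourhood of \<open>v = u\<close>, which is empty as well.
\<close>

definition distance_biregular :: "('a, 'b) pre_digraph \<Rightarrow> 'a set \<Rightarrow> 'a set \<Rightarrow> bool" where
  "distance_biregular G A B \<longleftrightarrow> graph G \<and> connected G \<and> bipartition G A B \<and>
     (\<forall>S \<in> {A, B}. \<exists>b c :: nat \<Rightarrow> nat. \<forall>u \<in> S. \<forall>i \<le> ecc G u. \<forall>v \<in> dist_layer G i u.
        card (dist_layer G (i + 1) u \<inter> dist_layer G 1 v) = b i \<and>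
        card (dist_layer G (i - 1) u \<inter> dist_layer G 1 v) = c i)"

text \<open>
  The common eccentricity of the vertices in a class; see \<open>distance_biregular_ecc\<close> below.
\<close>

definition class_ecc :: "('a, 'b) pre_digraph \<Rightarrow> 'a set \<Rightarrow> nat" where
  "class_ecc G S = (THE e. \<forall>u \<in> S. ecc G u = e)"

definition unbalanced :: "('a, 'b) pre_digraph \<Rightarrow> 'a set \<Rightarrow> 'a set \<Rightarrow> bool" where
  "unbalanced G A B \<longleftrightarrow> class_ecc G A \<noteq> class_ecc G B"

definition girth_deficiency_two :: "('a, 'b) pre_digraph \<Rightarrow> bool" where
  "girth_deficiency_two G \<longleftrightarrow> girth G = enat (2 * diameter G - 2)"

fun F_poly :: "nat \<Rightarrow> nat \<Rightarrow> nat \<Rightarrow> int poly" where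
  "F_poly k l 0 = 1"
| "F_poly k l (Suc 0) = [:0, 1:] + [:int k:]"
| "F_poly k l (Suc (Suc i)) = [:0, 1:] * F_poly k l (Suc i) - smult (int k * int l) (F_poly k l i)"

context graph
begin

lemma ex_awalk:
  assumes "connected G" "u \<in> verts G" "v \<in> verts G"
  shows "\<exists>p. awalk u p v"
  using symmetric_connected_imp_strongly_connected[OF sym_arcs assms(1)] assms(2,3)
  by (auto simp: reachable_awalk)

lemma gdist_awalk:
  assumes "awalk u p v"
  shows "\<exists>q. awalk u q v \<and> length q = gdist G u v"
  unfolding gdist_def by (rule LeastI_ex) (use assms in blast)

lemma gdist_le: "awalk u p v \<Longrightarrow> gdist G u v \<le> length p"
  unfolding gdist_def by (rule Least_le) blast

lemma gdist_le_ecc: "v \<in> verts G \<Longrightarrow> gdist G u v \<le> ecc G u"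
  unfolding ecc_def by (rule Max_ge) auto

lemma ecc_attained: "u \<in> verts G \<Longrightarrow> \<exists>v \<in> verts G. gdist G u v = ecc G u"
proof -
  assume "u \<in> verts G"
  then have "Max (gdist G u ` verts G) \<in> gdist G u ` verts G" by (intro Max_in) auto
  then show ?thesis unfolding ecc_def by auto
qed

lemma ex_adjacent_layer:
  assumes conn: "connected G" and u: "u \<in> verts G" and w: "w \<in> dist_layer G (Suc i) u"
  shows "\<exists>v \<in> dist_layer G i u. v \<rightarrow> w"
proof -
  from w have wv: "w \<in> verts G" and d: "gdist G u w = Suc i" by (auto simp: dist_layer_def)
  obtain q where q: "awalk u q w" "length q = Suc i"
    using gdist_awalk ex_awalk[OF conn u wv] d by metis
  obtain p a where pa: "q = p @ [a]" using q(2) by (metis length_Suc_conv_rev)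
  from q(1) pa obtain v where p: "awalk u p v" and a: "awalk v [a] w" by auto
  have vv: "v \<in> verts G" using p by auto
  have vw: "v \<rightarrow> w" using a by (auto simp: awalk_simps in_arcs_imp_in_arcs_ends)
  have le: "gdist G u v \<le> i" using gdist_le[OF p] q(2) pa by simp
  obtain p' where p': "awalk u p' v" "length p' = gdist G u v" using gdist_awalk[OF p] by blast
  have "awalk u (p' @ [a]) w" using p'(1) a by (rule awalk_appendI)
  from gdist_le[OF this] have "i \<le> gdist G u v" using d p'(2) by simp
  with le have "v \<in> dist_layer G i u" using vv by (simp add: dist_layer_def)
  with vw show ?thesis by blast
qed

lemma dist_layer_nonempty:
  assumes conn: "connected G" and u: "u \<in> verts G" and "i \<le> ecc G u"
  shows "\<exists>v. v \<in> dist_layer G i u"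
  using assms(3)
proof (induction rule: inc_induct)
  case base
  then show ?case using ecc_attained[OF u] by (auto simp: dist_layer_def)
next
  case (step n)
  then show ?case using ex_adjacent_layer[OF conn u] by blast
qed

lemma adjacent_dist_layer:
  assumes "v \<rightarrow> w" shows "w \<in> dist_layer G 1 v"
proof -
  from assms obtain a where "a \<in> arcs G" "v = tail G a" "w = head G a"
    by (auto simp: arcs_ends_conv)
  then have a: "awalk v [a] w" using arc_implies_awalk by simp
  obtain q where q: "awalk v q w" "length q = gdist G v w" using gdist_awalk[OF a] by blast
  have "v \<noteq> w" using assms by (auto dest: adj_not_same)
  then have "q \<noteq> []" using q(1) by (auto simp: awalk_simps)
  then have "gdist G v w = 1" using q(2) gdist_le[OF a] by (cases q) auto
  then show ?thesis using assms by (auto simp: dist_layer_def)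
qed

lemma finite_dist_layer: "finite (dist_layer G i u)"
  by (simp add: dist_layer_def)

end

lemma distance_biregular_ecc:
  assumes "distance_biregular G A B" and S: "S = A \<or> S = B" and "u \<in> S"
  shows "ecc G u = class_ecc G S"
proof -
  from assms(1) interpret graph G by (simp add: distance_biregular_def)
  from assms(1) have conn: "connected G" and "A \<union> B = verts G"
    by (auto simp: distance_biregular_def bipartition_def)
  with S have sub: "S \<subseteq> verts G" by blast
  from assms(1) S obtain b :: "nat \<Rightarrow> nat" where
    b: "\<And>x i v. x \<in> S \<Longrightarrow> i \<le> ecc G x \<Longrightarrow> v \<in> dist_layer G i x \<Longrightarrow>
          card (dist_layer G (i + 1) x \<inter> dist_layer G 1 v) = b i"
    unfolding distance_biregular_def by (metis insert_iff)
  have le: "ecc G y \<le> ecc G x" if xy: "x \<in> S" "y \<in> S" for x y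
  proof (rule ccontr)
    let ?i = "ecc G x"
    assume "\<not> ?thesis"
    then have lt: "Suc ?i \<le> ecc G y" by simp
    have yv: "y \<in> verts G" and xv: "x \<in> verts G" using xy sub by auto
    obtain w where w: "w \<in> dist_layer G (Suc ?i) y"
      using dist_layer_nonempty[OF conn yv lt] by blast
    obtain v where v: "v \<in> dist_layer G ?i y" "v \<rightarrow>\<^bsub>G\<^esub> w"
      using ex_adjacent_layer[OF conn yv w] by blast
    have "w \<in> dist_layer G (?i + 1) y \<inter> dist_layer G 1 v"
      using w adjacent_dist_layer[OF v(2)] by simp
    then have "b ?i \<noteq> 0" using b[OF xy(2) _ v(1)] lt finite_dist_layer
      by (metis Suc_leD card_0_eq empty_iff finite_Int)
    moreover obtain z where z: "z \<in> dist_layer G ?i x"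
      using dist_layer_nonempty[OF conn xv order_refl] by blast
    ultimately have "dist_layer G (?i + 1) x \<inter> dist_layer G 1 z \<noteq> {}"
      using b[OF xy(1) order_refl z] by auto
    then obtain t where "t \<in> verts G" "gdist G x t = ?i + 1" by (auto simp: dist_layer_def)
    with gdist_le_ecc[of t x] show False by simp
  qed
  have "(THE e. \<forall>u \<in> S. ecc G u = e) = ecc G u"
    using le \<open>u \<in> S\<close> by (intro the_equality) (auto intro: antisym)
  then show ?thesis by (simp add: class_ecc_def)
qed

end

theory Submission
  imports Defs "Jordan_Normal_Form.Schur_Decomposition"
begin

text \<open>
  Let \<open>N\<close> be the incidence matrix between \<open>B\<close> and \<open>A\<close>, and \<open>M = N N\<^sup>T - (k + l) I\<close>. Because the girth
  exceeds \<open>4 r\<close>, the matrix \<open>F\<^sub>i(M)\<close> with \<open>i \<le> r\<close> is the 0-1 matrix of the relation "at distance at most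
  \<open>2 i\<close>" on \<open>B\<close>. In particular all \<open>F\<^sub>i(M)\<close> have trace \<open>n = |B|\<close>, and \<open>F\<^sub>r(M)\<close> is the all-one matrix, so
  that the eigenvalues of \<open>M\<close> are \<open>\<eta> = 1 + k l\<close> and roots of \<open>F\<^sub>r\<close>. Computing the trace of the resolvent of
  \<open>M\<close> gives \<open>(X - \<eta>) F\<^sub>r \<chi>' = n G\<^sub>r \<chi>\<close> for the characteristic polynomial \<open>\<chi>\<close>, where \<open>G\<^sub>i\<close> satisfies the
  recurrence of \<open>F\<^sub>i\<close> with \<open>G\<^sub>0 = 1\<close> and \<open>G\<^sub>1 = X - k l\<close>. Hence a root \<open>\<theta>\<close> of \<open>F\<^sub>r\<close> of multiplicity \<open>m\<close> in \<open>\<chi>\<close>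
  satisfies \<open>m (\<theta> - \<eta>) F\<^sub>r'(\<theta>) = n G\<^sub>r(\<theta>)\<close>. In terms of Chebyshev-like polynomials this becomes a quadratic
  equation for \<open>\<theta>\<close> with integer coefficients depending on \<open>m\<close>, and conjugate roots have the same \<open>m\<close>. The
  quadratic is nonzero unless \<open>k = l = 1\<close>, which would make the graph balanced.
\<close>

section \<open>The polynomial identities\<close>

text \<open>Rescaled Chebyshev polynomials of the second kind: if \<open>X = s + t\<close> and
  \<open>a = s * t\<close>, then \<open>U_poly a n\<close> is \<open>(s^n - t^n) / (s - t)\<close>.
  \<open>F_poly\<close> and \<open>G_poly\<close> are combinations of two consecutive ones.\<close>

fun U_poly :: "int \<Rightarrow> nat \<Rightarrow> int poly" where
  "U_poly a 0 = 0"
| "U_poly a (Suc 0) = 1"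
| "U_poly a (Suc (Suc i)) = [:0, 1:] * U_poly a (Suc i) - [:a:] * U_poly a i"

lemma F_poly_U_poly:
  "F_poly k l i = U_poly (int k * int l) (Suc i) + [:int k:] * U_poly (int k * int l) i"
proof (induction k l i rule: F_poly.induct)
  case (3 k l i)
  have "x * (v' + c * v) - a * (v + c * u) = (x * v' - a * v) + c * (x * v - a * u)"
    for x c a u v v' :: "int poly" by (simp add: algebra_simps)
  from this[of "[:0,1:]" _ "[:int k:]" _ "[:int k * int l:]"] show ?case
    unfolding F_poly.simps 3 by simp
qed simp_all

text \<open>Analogue of the Chebyshev derivative formula: in terms of \<open>s\<close> and
  \<open>t\<close> with \<open>s + t = X\<close> and \<open>s * t = a\<close>, the factor
  \<open>X^2 - 4 * c\<close> is \<open>(s - t)^2\<close> and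
  \<open>2 * U_poly a (Suc n) - X * U_poly a n\<close> is \<open>s^n + t^n\<close>.\<close>

lemma pderiv_U_poly:
  fixes a :: int
  defines "X \<equiv> [:0, 1:] :: int poly" and "c \<equiv> [:a:] :: int poly"
  shows "(X\<^sup>2 - 4 * c) * pderiv (U_poly a n) =
    of_nat n * (2 * U_poly a (Suc n) - X * U_poly a n) - X * U_poly a n"
  unfolding c_def
proof (induction a n rule: U_poly.induct)
  case (1 a)
  then show ?case by simp
next
  case (2 a)
  then show ?case by (simp add: X_def)
next
  case (3 a n)
  define c where "c = [:a:]"
  \<comment> \<open>The inductive step with the polynomials replaced by variables; \<open>m\<close>
    stands for \<open>of_nat n\<close>.\<close>
  have gen: "(x\<^sup>2 - 4 * c) * (v + x * v' - c * u') =
     (1 + (1 + m)) * (2 * (x * (x * v - c * u) - c * v) - x * (x * v - c * u)) - x * (x * v - c * u)"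
    if "(x\<^sup>2 - 4 * c) * v' = (1 + m) * (2 * (x * v - c * u) - x * v) - x * v"
      "(x\<^sup>2 - 4 * c) * u' = m * (2 * v - x * u) - x * u"
    for x c v u v' u' m :: "int poly"
  proof -
    have "(x\<^sup>2 - 4 * c) * (v + x * v' - c * u') =
        (x\<^sup>2 - 4 * c) * v + x * ((x\<^sup>2 - 4 * c) * v') - c * ((x\<^sup>2 - 4 * c) * u')"
      by (simp add: algebra_simps)
    then show ?thesis unfolding that by (simp add: algebra_simps power2_eq_square)
  qed
  let ?u = "U_poly a n" and ?v = "U_poly a (Suc n)"
  have U: "U_poly a (Suc (Suc n)) = X * ?v - c * ?u"
    "U_poly a (Suc (Suc (Suc n))) = X * (X * ?v - c * ?u) - c * ?v"
    by (simp_all add: X_def c_def)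
  have dX: "pderiv X = 1" "pderiv c = 0" by (simp_all add: X_def pderiv_pCons c_def)
  have d: "pderiv (U_poly a (Suc (Suc n))) = ?v + X * pderiv ?v - c * pderiv ?u"
    unfolding U(1) pderiv_diff pderiv_mult dX by (simp add: algebra_simps)
  show ?case
    using gen[OF 3(1)[folded c_def, unfolded U(1) of_nat_Suc] 3(2)[folded c_def]]
    unfolding c_def[symmetric] U(2) d of_nat_Suc by (simp only: U(1))
qed


text \<open>
  For \<open>k * l \<noteq> 0\<close>, a root of \<open>F_poly k l r\<close> that has multiplicity \<open>m\<close> as an eigenvalue is a root of this
  quadratic, with \<open>n\<close> the number of vertices of \<open>B\<close>. Its value at \<open>1 + k * l\<close> is \<open>- n * (l + 1) * (k * l - 1)\<^sup>2\<close>.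
\<close>

definition Q_poly :: "nat \<Rightarrow> nat \<Rightarrow> nat \<Rightarrow> nat \<Rightarrow> nat \<Rightarrow> int poly" where
  "Q_poly k l r m n = of_nat m * [:- (1 + int k * int l), 1:] *
     (of_nat (2 * r + 1) * [:0, 1:] + of_nat (2 * (r + 1) * l + 2 * r * k))
   - of_nat n * [:int l + 1:] * ([:0, 1:]\<^sup>2 - 4 * [:int k * int l:])"

lemma degree_Q_poly: "degree (Q_poly k l r m n) \<le> 2"
proof -
  have "degree (of_nat a :: int poly) = 0" for a by (simp add: of_nat_poly)
  moreover have "(4 :: int poly) = [:4:]" by (simp add: numeral_poly)
  ultimately show ?thesis unfolding Q_poly_def power2_eq_square
    by (auto simp: of_nat_poly intro!: degree_diff_le order.trans[OF degree_smult_le]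
       simp flip: of_nat_add of_nat_mult)
qed

lemma Q_poly_nonzero:
  assumes "n > 0" "k * l \<noteq> 1"
  shows "Q_poly k l r m n \<noteq> 0"
proof
  define e where "e = 1 + int k * int l"
  assume "Q_poly k l r m n = 0"
  then have "poly (Q_poly k l r m n) e = 0" by simp
  then have "int n * (int l + 1) * (e\<^sup>2 - 4 * (int k * int l)) = 0"
    unfolding Q_poly_def e_def[symmetric] by (simp add: algebra_simps)
  then have "int n * (int l + 1) * ((1 + int k * int l)\<^sup>2 - 4 * (int k * int l)) = 0"
    by (simp only: e_def)
  moreover have "(1 + int k * int l)\<^sup>2 - 4 * (int k * int l) = (int k * int l - 1)\<^sup>2"
    by (simp add: power2_eq_square algebra_simps)
  ultimately have "int k * int l = 1" using assms(1) by simp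
  with assms(2) show False by (metis of_nat_mult of_nat_eq_1_iff)
qed

text \<open>The recurrence read backwards carries a nonconstant common factor down to
  \<open>U_poly a 1 = 1\<close>. Each step back removes a factor \<open>a\<close>, hence
  \<open>a \<noteq> 0\<close>.\<close>

lemma irreducible_dvd_U_poly:
  assumes p: "irreducible p" "p dvd U_poly a n" "p dvd U_poly a (Suc n)" and "a \<noteq> 0"
  shows "degree p = 0"
  using p(2,3)
proof (induction n)
  case 0
  then show ?case using p(1) by (simp add: irreducible_def)
next
  case (Suc n)
  have "[:a:] * U_poly a n = [:0, 1:] * U_poly a (Suc n) - U_poly a (Suc (Suc n))" by simp
  then have "p dvd [:a:] * U_poly a n" using Suc.prems by (metis dvd_diff dvd_mult)
  then consider "p dvd [:a:]" | "p dvd U_poly a n"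
    using prime_elem_dvd_mult_iff[of p] p(1) irreducible_imp_prime_elem by blast
  then show ?case
  proof cases
    case 1
    then show ?thesis using dvd_imp_degree_le[OF 1] \<open>a \<noteq> 0\<close> by simp
  next
    case 2
    then show ?thesis using Suc by blast
  qed
qed

fun G_poly :: "nat \<Rightarrow> nat \<Rightarrow> nat \<Rightarrow> int poly" where
  "G_poly k l 0 = 1"
| "G_poly k l (Suc 0) = [:- (int k * int l), 1:]"
| "G_poly k l (Suc (Suc i)) = [:0, 1:] * G_poly k l (Suc i) - [:int k * int l:] * G_poly k l i"

lemma G_poly_U_poly:
  "G_poly k l i = U_poly (int k * int l) (Suc i) - [:int k * int l:] * U_poly (int k * int l) i"
proof (induction k l i rule: G_poly.induct)
  case (3 k l i)
  have "x * (v' - a * v) - a * (v - a * u) = (x * v' - a * v) - a * (x * v - a * u)"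
    for x a u v v' :: "int poly" by (simp add: algebra_simps)
  from this[of "[:0,1:]" _ "[:int k * int l:]"] show ?case
    unfolding G_poly.simps 3 by simp
qed simp_all

text \<open>Modulo \<open>F_poly k l r\<close>, the polynomials \<open>U_poly\<close> at
  \<open>Suc r\<close> and \<open>Suc (Suc r)\<close> are multiples of \<open>u\<close>. The
  derivative formula and \<open>G_poly\<close> thus reduce to multiples of \<open>k * u\<close>, and
  the remaining cofactor is the quadratic up to sign.\<close>

lemma Q_poly_identity:
  fixes k l r m n :: nat
  defines "X \<equiv> [:0, 1:] :: int poly" and "c \<equiv> [:int k * int l:] :: int poly"
    and "u \<equiv> U_poly (int k * int l) r"
  shows "\<exists>h. (X\<^sup>2 - 4 * c) * (of_nat m * [:- (1 + int k * int l), 1:] * pderiv (F_poly k l r)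
      - of_nat n * G_poly k l r) = F_poly k l r * h - [:int k:] * u * Q_poly k l r m n"
proof -
  let ?F = "F_poly k l r" and ?v = "U_poly (int k * int l) (Suc r)"
  define K L where "K = [:int k:]" and "L = [:int l:]"
  define R where "R = (of_nat r :: int poly)"
  define M N where "M = (of_nat m :: int poly)" and "N = (of_nat n :: int poly)"
  have c: "c = K * L" by (simp add: c_def K_def L_def)
  have e: "[:- (1 + int k * int l), 1:] = X - 1 - K * L" by (simp add: X_def K_def L_def one_pCons)
  have L1: "[:int l + 1:] = L + 1" by (simp add: L_def one_pCons)
  have kl: "of_nat k = K" "of_nat l = L" by (simp_all add: K_def L_def of_nat_poly)
  have v: "?v = ?F - K * u" by (simp add: F_poly_U_poly u_def K_def)
  have w: "U_poly (int k * int l) (Suc (Suc r)) = X * (?F - K * u) - K * L * u"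
    unfolding U_poly.simps v X_def[symmetric] c_def[symmetric] u_def[symmetric] c ..
  have G: "G_poly k l r = ?F - K * u - K * L * u"
    using v by (simp add: G_poly_U_poly u_def flip: c c_def)
  have dF: "pderiv ?F = pderiv ?v + K * pderiv u"
    by (simp add: F_poly_U_poly u_def K_def pderiv_add pderiv_mult pderiv_smult)
  have "(X\<^sup>2 - 4 * c) * pderiv ?F = (X\<^sup>2 - 4 * c) * pderiv ?v + K * ((X\<^sup>2 - 4 * c) * pderiv u)"
    unfolding dF by (simp add: algebra_simps)
  also have "(X\<^sup>2 - 4 * c) * pderiv ?v = (R + 1) * (2 * (X * (?F - K * u) - K * L * u) - X * (?F - K * u)) - X * (?F - K * u)"
    using pderiv_U_poly[of "int k * int l" "Suc r"] unfolding w v X_def[symmetric] c_def[symmetric] of_nat_Suc R_def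
    by (simp add: algebra_simps)
  also have "(X\<^sup>2 - 4 * c) * pderiv u = R * (2 * (?F - K * u) - X * u) - X * u"
    using pderiv_U_poly[of "int k * int l" r] unfolding v X_def[symmetric] c_def[symmetric] R_def u_def[symmetric] .
  finally have D: "(X\<^sup>2 - 4 * c) * pderiv ?F =
     (R + 1) * (2 * (X * (?F - K * u) - K * L * u) - X * (?F - K * u)) - X * (?F - K * u)
      + K * (R * (2 * (?F - K * u) - X * u) - X * u)" .
  have Q: "Q_poly k l r m n = M * (X - 1 - K * L) * ((2 * R + 1) * X + (2 * (R + 1) * L + 2 * R * K))
      - N * (L + 1) * (X\<^sup>2 - 4 * c)"
    unfolding Q_poly_def e L1 X_def[symmetric] c_def[symmetric] M_def N_def R_def
    by (simp add: kl algebra_simps)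
  have "(X\<^sup>2 - 4 * c) * (M * (X - 1 - K * L) * pderiv ?F - N * G_poly k l r) =
     M * (X - 1 - K * L) * ((X\<^sup>2 - 4 * c) * pderiv ?F) - N * (X\<^sup>2 - 4 * c) * G_poly k l r"
    by (simp add: algebra_simps)
  also have "\<dots> = ?F * (M * (X - 1 - K * L) * (R * X + 2 * K * R) - N * (X\<^sup>2 - 4 * c))
      - K * u * Q_poly k l r m n"
    unfolding D G Q by (simp add: algebra_simps)
  finally show ?thesis unfolding e M_def N_def K_def by blast
qed

section \<open>The degenerate case of a vanishing product of the parameters\<close>

lemma F_poly_zero_right: "F_poly k l (Suc i) = [:0, 1:] ^ i * [:int k, 1:]" if "k * l = 0"
proof (induction i)
  case (Suc i)
  have "int k * int l = 0" using that by auto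
  with Suc show ?case by simp
qed simp

text \<open>For positive index the polynomial is a power of \<open>X\<close> times
  \<open>X + k\<close>. The case is treated apart because the general argument needs
  \<open>k\<close> and \<open>k * l\<close> to be nonzero constants.\<close>

lemma degree_irreducible_dvd_F_poly_zero:
  assumes p: "irreducible p" "p dvd F_poly k l i" and kl: "k * l = 0"
  shows "degree p \<le> 2"
proof -
  have pe: "prime_elem p" using p(1) by (rule irreducible_imp_prime_elem)
  have "p dvd [:0, 1:] \<or> p dvd [:int k, 1:]"
  proof (cases i)
    case 0
    then show ?thesis using p by (simp add: irreducible_def)
  next
    case (Suc j)
    with p(2) kl have "p dvd [:0, 1:] ^ j * [:int k, 1:]" using F_poly_zero_right by metis
    then show ?thesis using prime_elem_dvd_mult_iff[OF pe] prime_elem_dvd_power[OF pe] by blast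
  qed
  then show ?thesis by (auto dest!: dvd_imp_degree_le)
qed

text \<open>
  The differential equation for \<open>\<chi>\<close> is compared modulo \<open>p\<close> after dividing out the exact power of \<open>p\<close> in
  \<open>\<chi>\<close>; this is how the common multiplicity of all roots of \<open>p\<close> enters without extending the field.
\<close>

lemma degree_irreducible_factor_F_poly:
  assumes p: "irreducible p" "p dvd F_poly k l r" and n: "n > 0" and kl: "k * l \<noteq> 1"
    and chi: "\<chi> \<noteq> 0"
      "F_poly k l r * [:- (1 + int k * int l), 1:] * pderiv \<chi> = of_nat n * G_poly k l r * \<chi>"
  shows "degree p \<le> 2"
proof (cases "k * l = 0")
  case True
  then show ?thesis using degree_irreducible_dvd_F_poly_zero p by blast
next
  case False
  define a where "a = int k * int l"
  have a: "a \<noteq> 0" using False unfolding a_def by (metis of_nat_mult of_nat_eq_0_iff)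
  have pe: "prime_elem p" using p(1) by (rule irreducible_imp_prime_elem)
  define m where "m = multiplicity p \<chi>"
  obtain \<psi> where psi: "\<chi> = p ^ m * \<psi>" "\<not> p dvd \<psi>"
    using multiplicity_decompose'[of \<chi> p] chi(1) p(1) unfolding m_def irreducible_def by metis
  obtain f where f: "F_poly k l r = p * f" using p(2) by blast
  let ?e = "[:- (1 + int k * int l), 1:] :: int poly"
  have p0: "p \<noteq> 0" using p(1) by auto
  \<comment> \<open>Differentiating \<open>p ^ m\<close> loses one power of \<open>p\<close>; the
    factor \<open>p\<close> of \<open>F_poly k l r\<close> restores it, so that \<open>p ^ m\<close>
    cancels on both sides. This includes \<open>m = 0\<close>.\<close>
  have *: "f * ?e * (of_nat m * pderiv p * \<psi> + p * pderiv \<psi>) = of_nat n * G_poly k l r * \<psi>"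
  proof -
    have dpm: "p * pderiv (p ^ m) = p ^ m * (of_nat m * pderiv p)"
      by (cases m) (simp_all only: pderiv_power_Suc, simp_all add: of_nat_poly algebra_simps)
    have "p ^ m * (f * ?e * (of_nat m * pderiv p * \<psi> + p * pderiv \<psi>)) =
       f * ?e * ((p ^ m * (of_nat m * pderiv p)) * \<psi> + p ^ m * (p * pderiv \<psi>))"
      by (simp only: algebra_simps)
    also have "\<dots> = F_poly k l r * ?e * pderiv \<chi>"
      unfolding dpm[symmetric] f psi(1) pderiv_mult by (simp only: algebra_simps)
    also have "\<dots> = p ^ m * (of_nat n * G_poly k l r * \<psi>)"
      unfolding chi(2) unfolding psi(1) by (simp only: mult.assoc mult.left_commute)
    finally show ?thesis using p0 by (simp only: mult_cancel_left power_eq_0_iff) simp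
  qed
  let ?D = "of_nat m * ?e * pderiv (F_poly k l r) - of_nat n * G_poly k l r"
  \<comment> \<open>Modulo \<open>p\<close> the derivative of \<open>F_poly k l r = p * f\<close> is
    \<open>f * pderiv p\<close>, which is what the cancelled equation contains.\<close>
  have "?D * \<psi> = p * (of_nat m * ?e * pderiv f * \<psi> - f * ?e * pderiv \<psi>)"
    unfolding left_diff_distrib *[symmetric] f pderiv_mult by (simp only: algebra_simps)
  then have "p dvd ?D * \<psi>" by simp
  then have "p dvd ?D" using psi(2) pe by (simp add: prime_elem_dvd_mult_iff)
  let ?u = "U_poly a r"
  have diff_swap: "y = z - x" if "x = z - y" for x y z :: "int poly" using that by simp
  obtain h where "([:0, 1:]\<^sup>2 - 4 * [:a:]) * ?D = F_poly k l r * h - [:int k:] * ?u * Q_poly k l r m n"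
    using Q_poly_identity[of k l m r n] unfolding a_def by blast
  from diff_swap[OF this] have "p dvd [:int k:] * ?u * Q_poly k l r m n"
    using dvd_diff[OF dvd_mult2[OF p(2)] dvd_mult[OF \<open>p dvd ?D\<close>]] by (simp only:)
  then consider "p dvd [:int k:]" | "p dvd ?u" | "p dvd Q_poly k l r m n"
    using prime_elem_dvd_mult_iff[OF pe] by blast
  then show ?thesis
  proof cases
    case 1
    then show ?thesis using dvd_imp_degree_le[OF 1] False by simp
  next
    case 2
    \<comment> \<open>A common factor of \<open>?u\<close> and \<open>F_poly k l r\<close> also
      divides the next \<open>U_poly\<close>, so it is constant.\<close>
    then have "p dvd [:int k:] * ?u" by (rule dvd_mult)
    then have "p dvd U_poly a (Suc r)"
      using p(2) unfolding F_poly_U_poly a_def[symmetric] by (simp only: dvd_add_left_iff)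
    with 2 show ?thesis using irreducible_dvd_U_poly[OF p(1) _ _ a] by simp
  next
    case 3
    have "degree p \<le> degree (Q_poly k l r m n)"
      using dvd_imp_degree_le[OF 3] Q_poly_nonzero[OF n kl] by blast
    then show ?thesis using degree_Q_poly le_trans by blast
  qed
qed

section \<open>Characteristic polynomials and traces\<close>

definition mat_trace :: "'a::comm_monoid_add mat \<Rightarrow> 'a" where
  "mat_trace A = (\<Sum>i<dim_row A. A $$ (i, i))"

lemma mat_trace_mult_commute:
  fixes A B :: "'a::comm_semiring_0 mat"
  assumes "A \<in> carrier_mat n m" "B \<in> carrier_mat m n"
  shows "mat_trace (A * B) = mat_trace (B * A)"
proof -
  have "mat_trace (A * B) = (\<Sum>i<n. \<Sum>j<m. A $$ (i, j) * B $$ (j, i))"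
    using assms by (simp add: mat_trace_def scalar_prod_def atLeast0LessThan)
  also have "\<dots> = (\<Sum>j<m. \<Sum>i<n. B $$ (j, i) * A $$ (i, j))"
    by (subst sum.swap) (simp add: mult.commute)
  also have "\<dots> = mat_trace (B * A)"
    using assms by (simp add: mat_trace_def scalar_prod_def atLeast0LessThan)
  finally show ?thesis .
qed

lemma mat_trace_similar:
  fixes A B :: "'a::comm_ring_1 mat"
  assumes "similar_mat_wit A B P Q"
  shows "mat_trace A = mat_trace B"
proof -
  define n where "n = dim_row A"
  note s = similar_mat_witD[OF n_def assms]
  have "mat_trace A = mat_trace (P * (B * Q))" using s by simp
  also have "\<dots> = mat_trace (B * Q * P)" using s by (intro mat_trace_mult_commute) auto
  also have "B * Q * P = B" using s by (simp add: assoc_mult_mat[of B n n Q n P n])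
  finally show ?thesis .
qed

text \<open>A summand \<open>A $$ (i, m) * B $$ (m, j)\<close> can be nonzero only for
  \<open>i \<le> m \<le> j\<close>, a range that is empty below the diagonal and a single index on
  it.\<close>

lemma upper_triangular_mult:
  fixes A B :: "'a::semiring_0 mat"
  assumes c: "A \<in> carrier_mat n n" "B \<in> carrier_mat n n"
    and ut: "upper_triangular A" "upper_triangular B"
  shows "upper_triangular (A * B)"
    and "i < n \<Longrightarrow> (A * B) $$ (i, i) = A $$ (i, i) * B $$ (i, i)"
proof -
  have e: "(A * B) $$ (i, j) = (\<Sum>m<n. A $$ (i, m) * B $$ (m, j))" if "i < n" "j < n" for i j
    using c that by (simp add: scalar_prod_def atLeast0LessThan)
  have z: "A $$ (i, m) * B $$ (m, j) = 0" if "i < n" "m < n" "m < i \<or> j < m" for i j m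
    using ut c that by (auto dest: upper_triangularD)
  show "upper_triangular (A * B)"
  proof (rule upper_triangularI)
    fix i j assume "j < i" "i < dim_row (A * B)"
    with c have "j < i" "i < n" by auto
    then show "(A * B) $$ (i, j) = 0" using e[of i j] z[of i _ j]
      by (auto intro!: sum.neutral) (meson le_less_trans linorder_not_less)
  qed
  assume i: "i < n"
  have "(\<Sum>m<n. A $$ (i, m) * B $$ (m, i)) = (\<Sum>m\<in>{i}. A $$ (i, m) * B $$ (m, i))"
    using i z[OF i, of _ i] by (intro sum.mono_neutral_right) (auto, meson linorder_neqE_nat)
  then show "(A * B) $$ (i, i) = A $$ (i, i) * B $$ (i, i)" using e[OF i i] by simp
qed

section \<open>The polynomials evaluated at a matrix\<close>

text \<open>\<open>F_poly k l i\<close> evaluated at \<open>M\<close>, by the recurrence itself. The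
  coefficient ring is general, so that integer and complex matrices are both covered.\<close>

fun F_mat :: "nat \<Rightarrow> nat \<Rightarrow> 'a::comm_ring_1 mat \<Rightarrow> nat \<Rightarrow> 'a mat" where
  "F_mat k l M 0 = 1\<^sub>m (dim_row M)"
| "F_mat k l M (Suc 0) = M + of_nat k \<cdot>\<^sub>m 1\<^sub>m (dim_row M)"
| "F_mat k l M (Suc (Suc i)) = M * F_mat k l M (Suc i) - (of_nat k * of_nat l) \<cdot>\<^sub>m F_mat k l M i"

lemma F_mat_carrier: "M \<in> carrier_mat n n \<Longrightarrow> F_mat k l M i \<in> carrier_mat n n"
  by (induction k l M i rule: F_mat.induct) auto

text \<open>Eigenvalues are taken over the complex numbers, whereas the matrix and the resulting
  identity are integral.\<close>

lemma F_mat_of_int: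
  "M \<in> carrier_mat n n \<Longrightarrow>
    F_mat k l (map_mat of_int M) i = (map_mat of_int (F_mat k l M i) :: 'a::comm_ring_1 mat)"
proof (induction k l M i rule: F_mat.induct)
  case (3 k l M i)
  let ?h = "map_mat of_int :: int mat \<Rightarrow> 'a mat"
  note c = F_mat_carrier[OF 3(3), of k l]
  have "?h (M * F_mat k l M (Suc i)) = ?h M * ?h (F_mat k l M (Suc i))"
    using 3(3) c by (intro of_int_hom.mat_hom_mult)
  then have "F_mat k l (?h M) (Suc (Suc i)) =
      ?h (M * F_mat k l M (Suc i)) - (of_nat k * of_nat l) \<cdot>\<^sub>m ?h (F_mat k l M i)"
    using 3 by (simp del: F_mat.simps(2))
  also have "\<dots> = ?h (F_mat k l M (Suc (Suc i)))"
    using 3(3) c[of i] c[of "Suc i"]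
    by (intro eq_matI) (auto simp del: F_mat.simps(1,2) index_mult_mat(1))
  finally show ?case .
qed (auto intro!: eq_matI)

text \<open>Conjugation \<open>X \<mapsto> P * X * Q\<close> preserves sums, multiples and products,
  since \<open>Q * P\<close> is the identity.\<close>

lemma F_mat_similar:
  assumes "similar_mat_wit A B P Q"
  shows "similar_mat_wit (F_mat k l A i) (F_mat k l B i) P Q"
proof -
  define n where "n = dim_row A"
  note s = similar_mat_witD[OF n_def assms]
  have A: "A \<in> carrier_mat n n" and B: "B \<in> carrier_mat n n"
    and P: "P \<in> carrier_mat n n" and Q: "Q \<in> carrier_mat n n" using s by auto
  have QPX: "Q * (P * X) = X" if "X \<in> carrier_mat n n" for X
    using that s by (simp add: assoc_mult_mat[symmetric, OF Q P that])
  have add: "P * X * Q + P * Y * Q = P * (X + Y) * Q" and sub: "P * X * Q - P * Y * Q = P * (X - Y) * Q"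
    and sm: "c \<cdot>\<^sub>m (P * X * Q) = P * (c \<cdot>\<^sub>m X) * Q"
    and ml: "(P * X * Q) * (P * Y * Q) = P * (X * Y) * Q"
    if X: "X \<in> carrier_mat n n" and Y: "Y \<in> carrier_mat n n" for X Y c
  proof -
    show "P * X * Q + P * Y * Q = P * (X + Y) * Q"
      using X Y P Q by (simp add: mult_add_distrib_mat[of P n n] add_mult_distrib_mat[of "P * X" n n])
    show "P * X * Q - P * Y * Q = P * (X - Y) * Q"
      using X Y P Q by (simp add: mult_minus_distrib_mat[of P n n] minus_mult_distrib_mat[of "P * X" n n])
    show "c \<cdot>\<^sub>m (P * X * Q) = P * (c \<cdot>\<^sub>m X) * Q"
      using X Y P Q by (simp add: mult_smult_distrib[of P n n] mult_smult_assoc_mat[of "P * X" n n])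
    have "(P * X * Q) * (P * Y * Q) = P * X * (Q * (P * (Y * Q)))"
      unfolding assoc_mult_mat[OF P Y Q] using X Y P Q by (intro assoc_mult_mat) auto
    also have "Q * (P * (Y * Q)) = Y * Q" using Y Q by (intro QPX) auto
    also have "P * X * (Y * Q) = P * (X * Y) * Q"
      using X Y P Q by (simp add: assoc_mult_mat[of _ n n _ n _ n])
    finally show "(P * X * Q) * (P * Y * Q) = P * (X * Y) * Q" .
  qed
  have AB: "A = P * B * Q" and PQ: "P * Q = 1\<^sub>m n" and dim: "dim_row A = n" "dim_row B = n" using s by auto
  have one: "1\<^sub>m n = P * 1\<^sub>m n * Q" using PQ P by simp
  note c = F_mat_carrier[OF B, of k l]
  have "F_mat k l A i = P * F_mat k l B i * Q"
  proof (induction i rule: induct_nat_012)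
    case 0
    then show ?case using one dim by simp
  next
    case 1
    have "A + of_nat k \<cdot>\<^sub>m 1\<^sub>m n = P * B * Q + of_nat k \<cdot>\<^sub>m (P * 1\<^sub>m n * Q)"
      unfolding one[symmetric] using AB by simp
    also have "\<dots> = P * (B + of_nat k \<cdot>\<^sub>m 1\<^sub>m n) * Q"
      using sm[OF one_carrier_mat B] add[OF B] by simp
    finally show ?case by (simp add: dim)
  next
    case (ge2 i)
    have "A * (P * F_mat k l B (Suc i) * Q) = P * (B * F_mat k l B (Suc i)) * Q"
      unfolding AB by (rule ml[OF B c])
    then show ?case
      unfolding F_mat.simps(3) ge2 sm[OF c c] using sub[of "B * F_mat k l B (Suc i)" "(of_nat k * of_nat l) \<cdot>\<^sub>m F_mat k l B i"] B c[of i] c[of "Suc i"]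
      by (simp del: F_mat.simps)
  qed
  then show ?thesis
    using F_mat_carrier[OF A] c P Q PQ s by (intro similar_mat_witI[of P Q n]) auto
qed

text \<open>Diagonals of upper triangular matrices multiply entrywise, so each diagonal entry obeys
  the recurrence of \<open>F_poly\<close>.\<close>

lemma F_mat_upper_triangular:
  fixes T :: "'a::{comm_ring_1,ring_char_0} mat"
  assumes T: "T \<in> carrier_mat n n" "upper_triangular T"
  shows "upper_triangular (F_mat k l T i) \<and>
    (\<forall>j<n. F_mat k l T i $$ (j, j) = poly (of_int_poly (F_poly k l i)) (T $$ (j, j)))"
proof (induction i rule: induct_nat_012)
  case 0
  then show ?case using T by auto
next
  case 1
  then show ?case using T by (auto simp: hom_distribs dest!: upper_triangularD intro!: upper_triangularI)
next
  case (ge2 i)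
  note c = F_mat_carrier[OF T(1), of k l]
  note m = upper_triangular_mult[OF T(1) c T(2), of "Suc i"]
  have ut: "upper_triangular (T * F_mat k l T (Suc i))" using m(1) ge2 by blast
  have d: "(T * F_mat k l T (Suc i)) $$ (j, j) = T $$ (j, j) * poly (of_int_poly (F_poly k l (Suc i))) (T $$ (j, j))"
    if "j < n" for j using m(2) ge2 that by metis
  have "upper_triangular (F_mat k l T (Suc (Suc i)))"
  proof (rule upper_triangularI)
    fix a b assume "b < a" "a < dim_row (F_mat k l T (Suc (Suc i)))"
    with F_mat_carrier[OF T(1), of k l "Suc (Suc i)"] have ab: "b < a" "a < n" "b < n" by auto
    have "(T * F_mat k l T (Suc i)) $$ (a, b) = 0" using ut ab T(1) by (auto dest: upper_triangularD)
    moreover have "F_mat k l T i $$ (a, b) = 0" using ge2(1) ab c[of i] by (auto dest: upper_triangularD)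
    ultimately show "F_mat k l T (Suc (Suc i)) $$ (a, b) = 0"
      using ab c[of i] by (auto simp del: F_mat.simps(1,2) index_mult_mat)
  qed
  moreover have "F_mat k l T (Suc (Suc i)) $$ (j, j) = poly (of_int_poly (F_poly k l (Suc (Suc i)))) (T $$ (j, j))"
    if "j < n" for j
    using ge2(1) d[OF that] that c[of i] by (simp add: hom_distribs del: F_mat.simps(1,2) F_poly.simps(1,2) index_mult_mat)
  ultimately show ?case by blast
qed

section \<open>Divided differences and the differential equation\<close>

text \<open>The divided difference \<open>(F_i(X) - F_i(e)) / (X - e)\<close> of
  \<open>F_i = F_poly k l i\<close>, generated by a recurrence instead of a division.\<close>

fun D_poly :: "nat \<Rightarrow> nat \<Rightarrow> complex \<Rightarrow> nat \<Rightarrow> complex poly" where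
  "D_poly k l e 0 = 0"
| "D_poly k l e (Suc 0) = 1"
| "D_poly k l e (Suc (Suc i)) = [:0, 1:] * D_poly k l e (Suc i) +
     [:poly (of_int_poly (F_poly k l (Suc i))) e:] - [:of_nat k * of_nat l:] * D_poly k l e i"

lemma D_poly_divided_difference:
  "of_int_poly (F_poly k l i) = [:- e, 1:] * D_poly k l e i + [:poly (of_int_poly (F_poly k l i)) e:]"
proof (induction k l e i rule: D_poly.induct)
  case (3 k l e i)
  let ?f = "\<lambda>i. poly (of_int_poly (F_poly k l i)) e" and ?F = "\<lambda>i. of_int_poly (F_poly k l i) :: complex poly"
  define X E K f g where "X = ([:0, 1:] :: complex poly)" and "E = [:e:]"
    and "K = ([:of_nat k * of_nat l:] :: complex poly)" and "f = [:?f i:]" and "g = [:?f (Suc i):]"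
  have XE: "[:- e, 1:] = X - E" by (simp add: X_def E_def)
  have F: "?F (Suc (Suc i)) = X * ?F (Suc i) - K * ?F i"
    by (simp add: hom_distribs X_def K_def)
  have h: "[:?f (Suc (Suc i)):] = E * g - K * f"
    unfolding F by (simp add: X_def E_def K_def f_def g_def)
  have D: "D_poly k l e (Suc (Suc i)) = X * D_poly k l e (Suc i) + g - K * D_poly k l e i"
    by (simp add: X_def K_def g_def)
  have I: "?F (Suc i) = (X - E) * D_poly k l e (Suc i) + g" "?F i = (X - E) * D_poly k l e i + f"
    using 3 unfolding XE f_def g_def by auto
  show ?case unfolding h unfolding F D XE I by (simp add: algebra_simps)
qed (simp_all add: hom_distribs)

text \<open>The trace hypothesis turns the inhomogeneous term of the summed recurrence into the
  constant \<open>n\<close>. Multiplying by \<open>X - (1 + k * l)\<close> and adding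
  \<open>n\<close> makes the recurrence homogeneous, with the initial values of
  \<open>n * G_poly\<close>.\<close>

lemma sum_D_poly:
  assumes tr: "\<And>i. i \<le> r \<Longrightarrow> (\<Sum>j<n. poly (of_int_poly (F_poly k l i)) (e j)) = of_nat n"
  shows "i \<le> r \<Longrightarrow> [:- (1 + of_nat k * of_nat l), 1:] * (\<Sum>j<n. D_poly k l (e j) i) + of_nat n =
    of_nat n * of_int_poly (G_poly k l i)"
proof (induction i rule: induct_nat_012)
  case 1
  then show ?case by (simp add: hom_distribs of_nat_poly algebra_simps)
next
  case (ge2 i)
  define X K N where "X = ([:0, 1:] :: complex poly)" and "K = ([:of_nat k * of_nat l:] :: complex poly)"
    and "N = (of_nat n :: complex poly)"
  let ?T = "\<lambda>i. \<Sum>j<n. D_poly k l (e j) i" and ?G = "\<lambda>i. of_int_poly (G_poly k l i) :: complex poly"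
  have e: "[:- (1 + of_nat k * of_nat l), 1:] = X - 1 - K" by (simp add: X_def K_def one_pCons)
  have "(\<Sum>j<n. [:poly (of_int_poly (F_poly k l (Suc i))) (e j):]) =
      [:\<Sum>j<n. poly (of_int_poly (F_poly k l (Suc i))) (e j):]"
    by (induction n) simp_all
  also have "\<dots> = N" using tr[of "Suc i"] ge2(3) by (simp add: N_def of_nat_poly)
  finally have T: "?T (Suc (Suc i)) = X * ?T (Suc i) + N - K * ?T i"
    unfolding D_poly.simps sum_subtractf sum.distrib sum_distrib_left[symmetric] X_def[symmetric] K_def[symmetric]
    by simp
  have G: "?G (Suc (Suc i)) = X * ?G (Suc i) - K * ?G i"
    by (simp add: hom_distribs X_def K_def)
  have I: "(X - 1 - K) * ?T (Suc i) = N * ?G (Suc i) - N" "(X - 1 - K) * ?T i = N * ?G i - N"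
    using ge2 unfolding e N_def by (simp_all add: algebra_simps)
  have "(X - 1 - K) * ?T (Suc (Suc i)) + N =
      X * ((X - 1 - K) * ?T (Suc i)) + (X - 1 - K) * N - K * ((X - 1 - K) * ?T i) + N"
    unfolding T by (simp add: algebra_simps)
  also have "\<dots> = N * ?G (Suc (Suc i))"
    unfolding I G by (simp add: algebra_simps)
  finally show ?case unfolding e N_def .
qed simp

text \<open>
  The trace hypothesis turns the sum of the divided differences of \<open>F_poly k l r\<close> at the eigenvalues into
  \<open>G_poly k l r\<close>, while an eigenvalue other than \<open>1 + k * l\<close> is a root of \<open>F_poly k l r\<close>.
\<close>

lemma F_mat_char_poly_complex:
  fixes C :: "complex mat"
  assumes C: "C \<in> carrier_mat n n"
    and tr: "\<And>i. i \<le> r \<Longrightarrow> mat_trace (F_mat k l C i) = of_nat n"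
    and eig: "C * F_mat k l C r = (1 + of_nat k * of_nat l) \<cdot>\<^sub>m F_mat k l C r"
  shows "of_int_poly (F_poly k l r) * [:- (1 + of_nat k * of_nat l), 1:] * pderiv (char_poly C) =
    of_nat n * of_int_poly (G_poly k l r) * char_poly C"
proof -
  obtain es where "char_poly C = (\<Prod>a\<leftarrow>es. [:- a, 1:])" using char_poly_factorized[OF C] by blast
  from schur_decomposition_exists[OF C this] obtain T P Q where
    T: "T \<in> carrier_mat n n" "upper_triangular T" and sim: "similar_mat_wit C T P Q"
    unfolding similar_mat_def by blast
  \<comment> \<open>The diagonal of the Schur form lists the eigenvalues with multiplicity.\<close>
  define e where "e j = T $$ (j, j)" for j
  define f where "f i j = poly (of_int_poly (F_poly k l i)) (e j)" for i j
  note FT = F_mat_upper_triangular[OF T, of k l]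
  have f: "F_mat k l T i $$ (j, j) = f i j" if "j < n" for i j using FT that by (simp add: f_def e_def)
  have tr': "(\<Sum>j<n. f i j) = of_nat n" if "i \<le> r" for i
  proof -
    have "of_nat n = mat_trace (F_mat k l T i)"
      using mat_trace_similar[OF F_mat_similar[OF sim, of k l i]] tr[OF that] by simp
    also have "\<dots> = (\<Sum>j<n. f i j)"
      using F_mat_carrier[OF T(1), of k l i] f by (auto simp: mat_trace_def)
    finally show ?thesis by simp
  qed
  \<comment> \<open>Conjugation carries \<open>eig\<close> over to \<open>T\<close>. Its diagonal
    says that each \<open>e j\<close> is \<open>1 + k * l\<close> or a root of
    \<open>F_poly k l r\<close>.\<close>
  have eig': "e j * f r j = (1 + of_nat k * of_nat l) * f r j" if j: "j < n" for j
  proof -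
    let ?\<eta> = "1 + of_nat k * of_nat l :: complex"
    note s = similar_mat_witD2[OF C sim] and s' = similar_mat_witD2[OF F_mat_carrier[OF C, of k l r] F_mat_similar[OF sim, of k l r]]
    note F = F_mat_carrier[OF C, of k l r] and F' = F_mat_carrier[OF T(1), of k l r]
    have CP: "Q * C = T * Q" and FP: "F_mat k l C r * P = P * F_mat k l T r"
    proof -
      have "Q * C = Q * (P * (T * Q))" using s by simp
      also have "\<dots> = (Q * P) * (T * Q)" using s by (intro assoc_mult_mat[symmetric]) auto
      finally show "Q * C = T * Q" using s by auto
      have "F_mat k l C r * P = (P * F_mat k l T r) * Q * P" using s' by simp
      also have "\<dots> = (P * F_mat k l T r) * (Q * P)" using s s' F' by (intro assoc_mult_mat) auto
      finally show "F_mat k l C r * P = P * F_mat k l T r" using s s' F' by auto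
    qed
    have "Q * (P * F_mat k l T r) = Q * P * F_mat k l T r"
      using s F' by (intro assoc_mult_mat[symmetric]) auto
    also have "Q * P = 1\<^sub>m n" using s by simp
    finally have QP: "Q * (P * F_mat k l T r) = F_mat k l T r" using F' by simp
    then have "T * F_mat k l T r = T * (Q * (P * F_mat k l T r))" by simp
    also have "\<dots> = T * Q * (F_mat k l C r * P)" unfolding FP using s F' by (simp add: assoc_mult_mat[of T n n Q n _ n])
    also have "\<dots> = Q * (C * F_mat k l C r) * P" unfolding CP[symmetric] using s F C by (simp add: assoc_mult_mat[of _ n n _ n _ n])
    also have "\<dots> = ?\<eta> \<cdot>\<^sub>m (Q * (F_mat k l C r * P))" unfolding eig using s F
      by (simp add: mult_smult_distrib[of Q n n _ n] mult_smult_assoc_mat[of _ n n _ n] assoc_mult_mat[of _ n n _ n _ n])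
    also have "Q * (F_mat k l C r * P) = F_mat k l T r" unfolding FP by (rule QP)
    finally have "(T * F_mat k l T r) $$ (j, j) = (?\<eta> \<cdot>\<^sub>m F_mat k l T r) $$ (j, j)" by simp
    then show ?thesis
      using upper_triangular_mult(2)[OF T(1) F' T(2) _ j] FT[of r] f[OF j] F' j by (simp add: e_def)
  qed
  have chi: "char_poly C = (\<Prod>j<n. [:- e j, 1:])"
  proof -
    have "char_poly C = char_poly T" using sim by (intro char_poly_similar) (auto simp: similar_mat_def)
    also have "\<dots> = (\<Prod>a\<leftarrow>diag_mat T. [:- a, 1:])" using T by (rule char_poly_upper_triangular)
    also have "\<dots> = (\<Prod>j<n. [:- e j, 1:])"
      using T by (simp add: diag_mat_def e_def comp_def interv_sum_list_conv_sum_set_nat atLeast0LessThan prod.list_conv_set_nth)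
    finally show ?thesis .
  qed
  \<comment> \<open>The characteristic polynomial without its factor for \<open>j\<close>; the sum
    over \<open>j\<close> is its derivative.\<close>
  define \<chi> where "\<chi> j = (\<Prod>i\<in>{..<n} - {j}. [:- e i, 1:])" for j
  have chij: "[:- e j, 1:] * \<chi> j = char_poly C" if "j < n" for j
    unfolding chi \<chi>_def using that by (intro prod.remove[symmetric]) auto
  have dchi: "pderiv (char_poly C) = (\<Sum>j<n. \<chi> j)"
    unfolding chi \<chi>_def by (simp add: pderiv_prod pderiv_pCons)
  let ?E = "[:- (1 + of_nat k * of_nat l), 1:] :: complex poly" and ?F = "of_int_poly (F_poly k l r) :: complex poly"
  have "?F * ?E * \<chi> j = (?E * D_poly k l (e j) r + [:f r j:]) * char_poly C" if j: "j < n" for j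
  proof -
    \<comment> \<open>By \<open>eig'\<close> the two linear factors agree unless
      \<open>f r j = 0\<close>.\<close>
    have "[:f r j:] * ?E = [:f r j:] * [:- e j, 1:]"
      using eig'[OF j] by (simp add: algebra_simps)
    then have *: "[:f r j:] * ?E * \<chi> j = [:f r j:] * char_poly C"
      unfolding chij[OF j, symmetric] by (simp only: mult.assoc[symmetric])
    have "?F * ?E * \<chi> j = ([:- e j, 1:] * D_poly k l (e j) r + [:f r j:]) * ?E * \<chi> j"
      using D_poly_divided_difference[of k l r "e j"] unfolding f_def by simp
    also have "\<dots> = ?E * D_poly k l (e j) r * ([:- e j, 1:] * \<chi> j) + [:f r j:] * ?E * \<chi> j"
      by (simp only: algebra_simps)
    also have "\<dots> = (?E * D_poly k l (e j) r + [:f r j:]) * char_poly C"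
      unfolding * chij[OF j] by (simp only: algebra_simps)
    finally show ?thesis .
  qed
  then have "?F * ?E * pderiv (char_poly C) = (\<Sum>j<n. (?E * D_poly k l (e j) r + [:f r j:]) * char_poly C)"
    unfolding dchi sum_distrib_left by simp
  also have "\<dots> = (?E * (\<Sum>j<n. D_poly k l (e j) r) + (\<Sum>j<n. [:f r j:])) * char_poly C"
    by (simp only: sum_distrib_right[symmetric] sum.distrib sum_distrib_left[symmetric])
  also have "(\<Sum>j<n. [:f r j:]) = [:\<Sum>j<n. f r j:]" by (induction n) simp_all
  also have "\<dots> = of_nat n" using tr'[of r] by (simp add: of_nat_poly)
  also have "?E * (\<Sum>j<n. D_poly k l (e j) r) + of_nat n = of_nat n * of_int_poly (G_poly k l r)"
    using tr' unfolding f_def by (intro sum_D_poly[where r = r]) auto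
  finally show ?thesis .
qed

text \<open>Both sides of the complex identity are images of integer polynomials, and the embedding
  is injective.\<close>

lemma F_mat_char_poly:
  fixes M :: "int mat"
  assumes M: "M \<in> carrier_mat n n"
    and tr: "\<And>i. i \<le> r \<Longrightarrow> mat_trace (F_mat k l M i) = int n"
    and eig: "M * F_mat k l M r = (1 + int k * int l) \<cdot>\<^sub>m F_mat k l M r"
  shows "F_poly k l r * [:- (1 + int k * int l), 1:] * pderiv (char_poly M) =
    of_nat n * G_poly k l r * char_poly M"
proof -
  let ?C = "map_mat of_int M :: complex mat"
  have C: "?C \<in> carrier_mat n n" using M by simp
  note F = F_mat_of_int[OF M, of k l, where ?'a = complex]
  note c = F_mat_carrier[OF M, of k l]
  have tr': "mat_trace (F_mat k l ?C i) = of_nat n" if "i \<le> r" for i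
  proof -
    have "mat_trace (F_mat k l ?C i) = of_int (mat_trace (F_mat k l M i))"
      unfolding F mat_trace_def using c[of i] by auto
    then show ?thesis using tr[OF that] by simp
  qed
  have eig': "?C * F_mat k l ?C r = (1 + of_nat k * of_nat l) \<cdot>\<^sub>m F_mat k l ?C r"
  proof -
    have "?C * F_mat k l ?C r = map_mat of_int (M * F_mat k l M r)"
      unfolding F using M c by (intro of_int_hom.mat_hom_mult[symmetric])
    then show ?thesis unfolding eig F by (auto intro!: eq_matI)
  qed
  have "of_int_poly (F_poly k l r * [:- (1 + int k * int l), 1:] * pderiv (char_poly M)) =
      (of_int_poly (of_nat n * G_poly k l r * char_poly M) :: complex poly)"
    using F_mat_char_poly_complex[OF C tr' eig']
    unfolding of_int_hom.char_poly_hom[OF M] by (simp add: hom_distribs of_int_hom.map_poly_pderiv)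
  then show ?thesis by simp
qed

unbundle no funcset_syntax

section \<open>Half balls in biregular graphs of large girth\<close>

context graph
begin

lemma out_degree_card_nbrs: "out_degree G v = card {w. v \<rightarrow> w}"
proof -
  have "bij_betw (head G) (out_arcs G v) {w. v \<rightarrow> w}"
    unfolding bij_betw_def
  proof
    show "inj_on (head G) (out_arcs G v)"
      by (rule inj_onI, rule no_multi_arcs) (auto simp: arc_to_ends_def)
    show "head G ` out_arcs G v = {w. v \<rightarrow> w}"
      by (auto simp: arcs_ends_conv)
  qed
  then show ?thesis unfolding out_degree_def by (rule bij_betw_same_card)
qed

lemma finite_nbrs: "finite {w. v \<rightarrow> w}"
  by (rule finite_subset[of _ "verts G"]) auto

lemma adj_sym: "v \<rightarrow> w \<Longrightarrow> w \<rightarrow> v"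
  using sym_arcs unfolding symmetric_def by (rule symD)

lemma gdist_self: "u \<in> verts G \<Longrightarrow> gdist G u u = 0"
  using gdist_le[of u "[]" u] by (simp add: awalk_simps)

lemma gdist_eq_0D:
  assumes "connected G" "u \<in> verts G" "v \<in> verts G" "gdist G u v = 0"
  shows "u = v"
  using ex_awalk[OF assms(1-3)] gdist_awalk assms(4) by (metis awalk_Nil_iff length_0_conv)

lemma gdist_adj_le:
  assumes "connected G" "u \<in> verts G" "v \<rightarrow> w"
  shows "gdist G u w \<le> Suc (gdist G u v)"
proof -
  have "v \<in> verts G" using assms(3) by auto
  then obtain p where p: "awalk u p v" "length p = gdist G u v"
    using ex_awalk[OF assms(1,2)] gdist_awalk by metis
  from assms(3) obtain a where "a \<in> arcs G" "v = tail G a" "w = head G a"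
    by (auto simp: arcs_ends_conv)
  then have "awalk v [a] w" using arc_implies_awalk by simp
  from gdist_le[OF awalk_appendI[OF p(1) this]] show ?thesis using p(2) by simp
qed

text \<open>The cycle in \<open>two_parents_cycle\<close> is built as a list of vertices; an arc is
  chosen here for each consecutive pair.\<close>

lemma ex_awalk_verts:
  assumes "successively (\<lambda>x y. x \<rightarrow> y) vs" "vs \<noteq> []" "set vs \<subseteq> verts G"
  shows "\<exists>p. awalk (hd vs) p (last vs) \<and> awalk_verts (hd vs) p = vs"
  using assms
proof (induction vs)
  case (Cons v vs)
  show ?case
  proof (cases vs)
    case Nil
    then have "awalk v [] v \<and> awalk_verts v [] = [v]" using Cons.prems by (simp add: awalk_simps)
    then show ?thesis using Nil by auto
  next
    case (Cons w ws)
    with Cons.prems Cons.IH obtain p where p: "awalk w p (last vs)" "awalk_verts w p = vs"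
      and vw: "v \<rightarrow> w" by auto
    from vw obtain a where a: "a \<in> arcs G" "v = tail G a" "w = head G a"
      by (auto simp: arcs_ends_conv)
    have "awalk v (a # p) (last vs)" "awalk_verts v (a # p) = v # vs"
      using a p by (simp_all add: awalk_Cons_iff)
    then show ?thesis using Cons by auto
  qed
qed simp

lemma ex_parent_function:
  assumes conn: "connected G" and u: "u \<in> verts G"
  shows "\<exists>par. \<forall>w \<in> verts G. gdist G u w > 0 \<longrightarrow>
    par w \<rightarrow> w \<and> gdist G u w = Suc (gdist G u (par w))"
proof -
  have "\<exists>v. v \<rightarrow> w \<and> gdist G u w = Suc (gdist G u v)" if w: "w \<in> verts G" "gdist G u w > 0" for w
  proof -
    obtain i where i: "gdist G u w = Suc i" using w(2) gr0_implies_Suc by blast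
    then have "w \<in> dist_layer G (Suc i) u" using w by (simp add: dist_layer_def)
    from ex_adjacent_layer[OF conn u this] show ?thesis using i by (auto simp: dist_layer_def)
  qed
  then show ?thesis by metis
qed

text \<open>The cycle follows geodesics back from the two parents until they first meet.\<close>

lemma two_parents_cycle:
  assumes conn: "connected G" and u: "u \<in> verts G" and v: "gdist G u v = Suc j"
    and x: "x \<rightarrow> v" "gdist G u x = j" and y: "y \<rightarrow> v" "gdist G u y = j" and xy: "x \<noteq> y"
  shows "\<exists>p. cycle p \<and> 3 \<le> length p \<and> length p \<le> 2 * Suc j"
proof -
  obtain par where par: "\<And>w. w \<in> verts G \<Longrightarrow> gdist G u w > 0 \<Longrightarrow>
      par w \<rightarrow> w \<and> gdist G u w = Suc (gdist G u (par w))"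
    using ex_parent_function[OF conn u] by blast
  \<comment> \<open>The \<open>i\<close>-th ancestor on a geodesic towards \<open>u\<close>; for
    \<open>z\<close> at distance \<open>j\<close> it is at distance \<open>j - i\<close>.\<close>
  define anc where "anc z i = (par ^^ i) z" for z i
  have anc: "anc z i \<in> verts G \<and> gdist G u (anc z i) = j - i" if "z \<in> verts G" "gdist G u z = j" "i \<le> j" for z i
    using that(3)
  proof (induction i)
    case 0
    then show ?case using that by (simp add: anc_def)
  next
    case (Suc i)
    then have "anc z i \<in> verts G" "gdist G u (anc z i) = j - i" by auto
    then have "par (anc z i) \<rightarrow> anc z i" "gdist G u (anc z i) = Suc (gdist G u (par (anc z i)))"
      using par[of "anc z i"] Suc.prems by auto
    with \<open>gdist G u (anc z i) = j - i\<close> show ?case by (auto simp: anc_def dest: adj_in_verts)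
  qed
  have anc_adj: "anc z (Suc i) \<rightarrow> anc z i" if "z \<in> verts G" "gdist G u z = j" "i < j" for z i
    using par[of "anc z i"] anc[OF that(1,2), of i] that(3) by (auto simp: anc_def)
  have xV: "x \<in> verts G" and yV: "y \<in> verts G" and vV: "v \<in> verts G" using x y by auto
  have "anc x j = u" "anc y j = u"
    using anc[OF xV x(2), of j] anc[OF yV y(2), of j] gdist_eq_0D[OF conn u] by auto
  then have ex: "anc x j = anc y j" by simp
  \<comment> \<open>The first index at which the two geodesics meet; both are at \<open>u\<close>
    after \<open>j\<close> steps.\<close>
  define m where "m = (LEAST i. anc x i = anc y i)"
  have m: "anc x m = anc y m" unfolding m_def by (rule LeastI[of _ j]) (rule ex)
  have mj: "m \<le> j" unfolding m_def by (rule Least_le) (rule ex)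
  have lt_m: "anc x i \<noteq> anc y i" if "i < m" for i
    using that not_less_Least unfolding m_def by blast
  have m0: "m > 0" using m xy by (cases m) (auto simp: anc_def)
  \<comment> \<open>From the meeting vertex along the first geodesic to \<open>x\<close>, then
    through \<open>v\<close> to \<open>y\<close> and back up the second one. The meeting vertex
    stands at both ends.\<close>
  define vs where "vs = anc x m # map (anc x) (rev [0..<m]) @ v # map (anc y) [0..<Suc m]"
  \<comment> \<open>Ancestors of different index lie in different layers, those of equal index
    differ before \<open>m\<close>, and \<open>v\<close> lies one layer beyond \<open>x\<close> and
    \<open>y\<close>. This separates all vertices of \<open>tl vs\<close>.\<close>
  have level: "gdist G u (anc x i) = j - i" "gdist G u (anc y i) = j - i" if "i \<le> m" for i
    using anc[OF xV x(2), of i] anc[OF yV y(2), of i] that mj by auto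
  have level_eq: "i = i'" if "i \<le> m" "i' \<le> m" "j - i = j - i'" for i i'
    using that mj by linarith
  have inj_x: "i = i'" if "anc x i = anc x i'" "i \<le> m" "i' \<le> m" for i i'
    using level(1)[of i] level(1)[of i'] level_eq[of i i'] that by simp
  have inj_y: "i = i'" if "anc y i = anc y i'" "i \<le> m" "i' \<le> m" for i i'
    using level(2)[of i] level(2)[of i'] level_eq[of i i'] that by simp
  have ne: "anc x i \<noteq> anc y i'" if "i < m" "i' \<le> m" for i i'
    using lt_m[OF that(1)] level(1)[of i] level(2)[of i'] level_eq[of i i'] that by auto
  have ne_v: "v \<noteq> anc x i" "v \<noteq> anc y i" if "i \<le> m" for i
    using level[OF that] v by auto
  have "distinct (map (anc x) (rev [0..<m]))"
    by (auto simp: distinct_map intro!: inj_onI inj_x)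
  moreover have "distinct (map (anc y) [0..<Suc m])"
    by (auto simp: distinct_map simp del: upt_Suc intro!: inj_onI inj_y)
  moreover have "set (map (anc x) (rev [0..<m])) \<inter> set (v # map (anc y) [0..<Suc m]) = {}"
  proof -
    have disjoint: "set (map (anc x) (rev [0..<m])) \<inter> S = {}" if "\<And>i. i < m \<Longrightarrow> anc x i \<notin> S" for S
      using that by auto
    have "anc x i \<notin> set (v # map (anc y) [0..<Suc m])" if "i < m" for i
    proof
      assume "anc x i \<in> set (v # map (anc y) [0..<Suc m])"
      then consider "anc x i = v" | i' where "i' \<le> m" "anc x i = anc y i'"
        by (auto simp: less_Suc_eq_le simp del: upt_Suc)
      then show False
      proof cases
        case 1
        then show False using ne_v(1)[of i] that by simp
      next
        case 2
        then show False using ne[OF that] by blast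
      qed
    qed
    then show ?thesis by (rule disjoint)
  qed
  moreover have "v \<notin> set (map (anc y) [0..<Suc m])"
  proof
    assume "v \<in> set (map (anc y) [0..<Suc m])"
    then obtain i where "i \<le> m" "v = anc y i" by (auto simp: less_Suc_eq_le simp del: upt_Suc)
    then show False using ne_v(2) by blast
  qed
  ultimately have "distinct (tl vs)"
    unfolding vs_def list.sel distinct_append distinct.simps by blast
  moreover have "set vs \<subseteq> verts G"
    using anc[OF xV x(2)] anc[OF yV y(2)] mj vV by (auto simp: vs_def simp del: upt_Suc)
  moreover have "successively (\<lambda>x y. x \<rightarrow> y) vs"
  proof -
    have 1: "successively (\<lambda>x y. x \<rightarrow> y) (map (anc x) (rev [0..<Suc n]))" if "n \<le> m" for n
      using that
    proof (induction n)
      case (Suc n)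
      then show ?case using anc_adj[OF xV x(2), of n] mj by (simp add: successively_Cons)
    qed simp
    have 2: "successively (\<lambda>x y. x \<rightarrow> y) (map (anc y) [0..<Suc n])" if "n \<le> m" for n
      using that
    proof (induction n)
      case (Suc n)
      then have "anc y n \<rightarrow> anc y (Suc n)" using anc_adj[OF yV y(2), of n] mj adj_sym by auto
      with Suc show ?case by (simp add: successively_append_iff)
    qed simp
    have vs: "vs = map (anc x) (rev [0..<Suc m]) @ v # map (anc y) [0..<Suc m]" by (simp add: vs_def)
    have l: "last (map (anc x) (rev [0..<Suc m])) = x" "hd (map (anc y) [0..<Suc m]) = y"
      by (simp_all add: last_map last_rev hd_map anc_def del: upt_Suc)
    have vy: "v \<rightarrow> y" using y(1) by (rule adj_sym)
    show ?thesis unfolding vs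
      using 1[of m] 2[of m] l x(1) vy by (simp add: successively_append_iff successively_Cons del: upt_Suc)
  qed
  moreover have "vs \<noteq> []" "hd vs = anc x m" "last vs = anc x m" using m by (simp_all add: vs_def)
  ultimately obtain p where p: "awalk (anc x m) p (anc x m)" "awalk_verts (anc x m) p = vs"
    using ex_awalk_verts[of vs] by auto
  have "length vs = Suc (2 * Suc m)" by (simp add: vs_def)
  then have len: "length p = 2 * Suc m" using p length_awalk_verts[of "anc x m" p] by simp
  moreover have "cycle p" unfolding cycle_def using p \<open>distinct (tl vs)\<close> len by auto
  ultimately show ?thesis using m0 mj by auto
qed

end

section \<open>Tree-like neighbourhoods in biregular graphs\<close>

locale biregular_graph = graph G for G :: "('a, 'b) pre_digraph" (structure) +
  fixes A B :: "'a set" and k l r :: nat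
  assumes conn: "connected G" and bip: "bipartition G A B"
    and deg_A: "\<And>v. v \<in> A \<Longrightarrow> card {w. v \<rightarrow> w} = k + 1"
    and deg_B: "\<And>v. v \<in> B \<Longrightarrow> card {w. v \<rightarrow> w} = l + 1"
    and no_short_cycle: "\<And>p. cycle p \<Longrightarrow> 3 \<le> length p \<Longrightarrow> 4 * r < length p"
begin

lemma verts_AB: "verts G = A \<union> B" and AB_disjoint: "A \<inter> B = {}"
  using bip by (auto simp: bipartition_def)

lemma adj_A: "v \<in> A \<Longrightarrow> v \<rightarrow> w \<Longrightarrow> w \<in> B" and adj_B: "v \<in> B \<Longrightarrow> v \<rightarrow> w \<Longrightarrow> w \<in> A"
  using bip AB_disjoint unfolding bipartition_def by blast+

lemma awalk_parity: "awalk u p v \<Longrightarrow> even (length p) \<longleftrightarrow> (u \<in> A \<longleftrightarrow> v \<in> A)"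
proof (induction p arbitrary: u)
  case (Cons a p)
  then have w: "awalk (head G a) p v" and ends: "tail G a = u" "u \<rightarrow> head G a"
    by (auto simp: awalk_Cons_iff intro: in_arcs_imp_in_arcs_ends)
  have "u \<in> A \<longleftrightarrow> head G a \<notin> A"
    using ends(2) bip AB_disjoint unfolding bipartition_def by blast
  then show ?case using Cons.IH[OF w] by auto
qed (auto simp: awalk_simps)

lemma gdist_parity:
  assumes "u \<in> verts G" "v \<in> verts G"
  shows "even (gdist G u v) \<longleftrightarrow> (u \<in> A \<longleftrightarrow> v \<in> A)"
  using ex_awalk[OF conn assms] gdist_awalk awalk_parity by metis

lemma gdist_adj:
  assumes "u \<in> verts G" "v \<rightarrow> w"
  shows "gdist G u w = Suc (gdist G u v) \<or> gdist G u v = Suc (gdist G u w)"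
proof -
  have "v \<in> verts G" "w \<in> verts G" using assms(2) by auto
  moreover have "v \<in> A \<longleftrightarrow> w \<notin> A" using adj_A adj_B assms(2) AB_disjoint verts_AB calculation by blast
  ultimately have "even (gdist G u v) \<noteq> even (gdist G u w)" using gdist_parity assms(1) by auto
  then have "gdist G u v \<noteq> gdist G u w" by auto
  then show ?thesis using gdist_adj_le[OF conn assms(1,2)] gdist_adj_le[OF conn assms(1) adj_sym[OF assms(2)]]
    by linarith
qed

text \<open>Two neighbours of \<open>v\<close> closer to \<open>u\<close> would give a cycle of
  length at most \<open>2 * Suc j \<le> 4 * r\<close>.\<close>

lemma card_parents:
  assumes u: "u \<in> verts G" and v: "v \<in> verts G" "gdist G u v = Suc j" and j: "Suc j \<le> 2 * r"
  shows "card {w. v \<rightarrow> w \<and> gdist G u w = j} = 1"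
proof -
  obtain x where x: "x \<rightarrow> v" "gdist G u x = j"
    using ex_parent_function[OF conn u] v by (metis Suc_inject zero_less_Suc)
  have "y = x" if y: "v \<rightarrow> y" "gdist G u y = j" for y
  proof (rule ccontr)
    assume "y \<noteq> x"
    from two_parents_cycle[OF conn u v(2) adj_sym[OF y(1)] y(2) x this]
    obtain p where "cycle p" "3 \<le> length p" "length p \<le> 2 * Suc j" by blast
    moreover have "2 * Suc j \<le> 4 * r" using j by simp
    ultimately show False using no_short_cycle[of p] by simp
  qed
  then have "{w. v \<rightarrow> w \<and> gdist G u w = j} = {x}" using x adj_sym by auto
  then show ?thesis by simp
qed

text \<open>
  The parity condition makes the neighbour sums satisfy a two-term recurrence in the radius; for even
  radius and centre in \<open>B\<close> the half balls are the entries of the matrices \<open>F_mat\<close>.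
\<close>

definition half_ball :: "'a \<Rightarrow> nat \<Rightarrow> 'a \<Rightarrow> int" where
  "half_ball u j v = of_bool (gdist G u v \<le> j \<and> even (gdist G u v + j))"

lemma half_ball_adj_sum_0:
  assumes u: "u \<in> verts G" and v: "v \<in> verts G" and r: "r \<ge> 1"
  shows "(\<Sum>w | v \<rightarrow> w. half_ball u 0 w) = half_ball u (Suc 0) v"
proof -
  have "(\<Sum>w | v \<rightarrow> w. half_ball u 0 w) = int (card {w. v \<rightarrow> w \<and> gdist G u w = 0})"
    using finite_nbrs[of v] by (simp add: half_ball_def of_bool_def sum.If_cases Int_def cong: conj_cong)
  also have "\<dots> = half_ball u (Suc 0) v"
  proof (cases "gdist G u v = Suc 0")
    case True
    with r show ?thesis using card_parents[OF u v True] by (simp add: half_ball_def)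
  next
    case False
    then have none: "{w. v \<rightarrow> w \<and> gdist G u w = 0} = {}" using gdist_adj[OF u, of v] by force
    show ?thesis unfolding none using False by (auto simp: half_ball_def le_Suc_eq intro: odd_pos)
  qed
  finally show ?thesis .
qed

text \<open>When \<open>v\<close> has the parity of \<open>j\<close>, all its neighbours count if
  its distance is at most \<open>j\<close>, exactly one counts at distance \<open>j + 2\<close> by
  \<open>card_parents\<close>, and none beyond. For the other parity both sides vanish.\<close>

lemma half_ball_adj_sum:
  assumes u: "u \<in> verts G" and v: "v \<in> verts G" and j: "j + 2 \<le> 2 * r"
  shows "(\<Sum>w | v \<rightarrow> w. half_ball u (Suc j) w) =
    half_ball u (Suc (Suc j)) v + (int (card {w. v \<rightarrow> w}) - 1) * half_ball u j v"
proof -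
  let ?d = "gdist G u v"
  note adj = gdist_adj[OF u, of v]
  show ?thesis
  proof (cases "even (?d + j)")
    case False
    have "half_ball u (Suc j) w = 0" if "v \<rightarrow> w" for w
      using adj[OF that] False by (auto simp: half_ball_def)
    then have "(\<Sum>w | v \<rightarrow> w. half_ball u (Suc j) w) = 0" by (intro sum.neutral) auto
    then show ?thesis using False by (simp add: half_ball_def)
  next
    case True
    have par: "even (gdist G u w + Suc j)" if "v \<rightarrow> w" for w
      using adj[OF that] True by auto
    have "?d \<noteq> j + 1" using True by auto
    then have "?d \<le> j \<or> ?d = j + 2 \<or> ?d > j + 2" by linarith
    then consider "?d \<le> j" | "?d = j + 2" | "?d > j + 2" by blast
    then show ?thesis
    proof cases
      case 1
      have "half_ball u (Suc j) w = 1" if "v \<rightarrow> w" for w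
        using adj[OF that] par[OF that] 1 by (auto simp: half_ball_def)
      then have "(\<Sum>w | v \<rightarrow> w. half_ball u (Suc j) w) = int (card {w. v \<rightarrow> w})" by simp
      then show ?thesis using 1 True by (simp add: half_ball_def)
    next
      case 2
      have "half_ball u (Suc j) w = of_bool (gdist G u w = Suc j)" if "v \<rightarrow> w" for w
        using adj[OF that] par[OF that] 2 by (auto simp: half_ball_def)
      then have "(\<Sum>w | v \<rightarrow> w. half_ball u (Suc j) w) = (\<Sum>w | v \<rightarrow> w. of_bool (gdist G u w = Suc j))"
        by simp
      also have "\<dots> = int (card {w. v \<rightarrow> w \<and> gdist G u w = Suc j})"
        using finite_nbrs[of v] by (simp add: of_bool_def sum.If_cases Int_def)
      also have "\<dots> = 1" using card_parents[OF u v] 2 j by simp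
      finally show ?thesis using 2 by (simp add: half_ball_def)
    next
      case 3
      have "half_ball u (Suc j) w = 0" if "v \<rightarrow> w" for w
        using adj[OF that] 3 by (auto simp: half_ball_def)
      then have "(\<Sum>w | v \<rightarrow> w. half_ball u (Suc j) w) = 0" by (intro sum.neutral) auto
      then show ?thesis using 3 by (simp add: half_ball_def)
    qed
  qed
qed

text \<open>The one-step rule is applied at the neighbours in \<open>A\<close>, then at
  \<open>v\<close>. After subtracting \<open>k + l\<close> times the middle half ball this is the
  recurrence of \<open>F_poly\<close> for \<open>j = 2 * i\<close>.\<close>

lemma half_ball_adj_adj_sum:
  assumes u: "u \<in> verts G" and v: "v \<in> B" and j: "j + 4 \<le> 2 * r"
  shows "(\<Sum>w | v \<rightarrow> w. \<Sum>x | w \<rightarrow> x. half_ball u (j + 2) x) =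
    half_ball u (j + 4) v + (int k + int l) * half_ball u (j + 2) v + int k * int l * half_ball u j v"
proof -
  have vV: "v \<in> verts G" using v verts_AB by simp
  have "(\<Sum>w | v \<rightarrow> w. \<Sum>x | w \<rightarrow> x. half_ball u (j + 2) x) =
      (\<Sum>w | v \<rightarrow> w. half_ball u (Suc (j + 2)) w + int k * half_ball u (Suc j) w)"
    using j half_ball_adj_sum[OF u, of _ "Suc j"] adj_B[OF v] deg_A
    by (intro sum.cong refl) (simp add: verts_AB)
  also have "\<dots> = half_ball u (j + 4) v + int l * half_ball u (j + 2) v +
      int k * (half_ball u (j + 2) v + int l * half_ball u j v)"
    using half_ball_adj_sum[OF u vV, of "j + 2"] half_ball_adj_sum[OF u vV, of j] j deg_B[OF v]
    by (simp add: sum.distrib sum_distrib_left[symmetric] eval_nat_numeral)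
  finally show ?thesis by (simp add: algebra_simps)
qed

text \<open>At radius 0 the first step has no correction term, so the coefficient is
  \<open>l\<close> instead of \<open>k + l\<close>. The difference is the summand \<open>k\<close>
  in \<open>F_poly k l 1\<close>.\<close>

lemma half_ball_adj_adj_sum_0:
  assumes u: "u \<in> verts G" and v: "v \<in> B" and r: "r \<ge> 1"
  shows "(\<Sum>w | v \<rightarrow> w. \<Sum>x | w \<rightarrow> x. half_ball u 0 x) = half_ball u 2 v + int l * half_ball u 0 v"
proof -
  have vV: "v \<in> verts G" using v verts_AB by simp
  have "(\<Sum>w | v \<rightarrow> w. \<Sum>x | w \<rightarrow> x. half_ball u 0 x) = (\<Sum>w | v \<rightarrow> w. half_ball u (Suc 0) w)"
    using half_ball_adj_sum_0[OF u _ r] by (intro sum.cong refl) auto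
  also have "\<dots> = half_ball u 2 v + int l * half_ball u 0 v"
    using half_ball_adj_sum[OF u vV, of 0] r deg_B[OF v] by (simp add: eval_nat_numeral)
  finally show ?thesis .
qed

section \<open>The matrix of two-step walks on \<open>B\<close>\<close>

lemma adj_adj_sum:
  fixes f :: "'a \<Rightarrow> int"
  assumes v: "v \<in> B"
  shows "(\<Sum>x\<in>B. int (card {w. v \<rightarrow> w \<and> w \<rightarrow> x}) * f x) = (\<Sum>w | v \<rightarrow> w. \<Sum>x | w \<rightarrow> x. f x)"
proof -
  have B: "finite B" using finite_verts verts_AB by simp
  have "(\<Sum>w | v \<rightarrow> w. \<Sum>x | w \<rightarrow> x. f x) = (\<Sum>w | v \<rightarrow> w. \<Sum>x\<in>B. if w \<rightarrow> x then f x else 0)"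
  proof (rule sum.cong[OF refl])
    fix w assume "w \<in> {w. v \<rightarrow> w}"
    then have "{x. w \<rightarrow> x} = B \<inter> {x. w \<rightarrow> x}" using adj_A adj_B[OF v] by blast
    then show "(\<Sum>x | w \<rightarrow> x. f x) = (\<Sum>x\<in>B. if w \<rightarrow> x then f x else 0)"
      using B by (simp add: sum.If_cases)
  qed
  also have "\<dots> = (\<Sum>x\<in>B. \<Sum>w | v \<rightarrow> w. if w \<rightarrow> x then f x else 0)" by (rule sum.swap)
  also have "\<dots> = (\<Sum>x\<in>B. int (card {w. v \<rightarrow> w \<and> w \<rightarrow> x}) * f x)"
    using finite_nbrs[of v] by (intro sum.cong refl) (simp add: sum.If_cases Int_def)
  finally show ?thesis by simp
qed

text \<open>The witness is the characteristic polynomial of the shifted two-step matrix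
  \<open>M\<close>, whose \<open>F_mat\<close> are the half-ball matrices
  \<open>H i\<close>.\<close>

lemma char_poly_identity:
  assumes r: "r \<ge> 1" and diam: "\<And>u v. u \<in> B \<Longrightarrow> v \<in> B \<Longrightarrow> gdist G u v \<le> 2 * r"
  shows "\<exists>\<chi>. \<chi> \<noteq> 0 \<and> F_poly k l r * [:- (1 + int k * int l), 1:] * pderiv \<chi> =
    of_nat (card B) * G_poly k l r * \<chi>"
proof -
  have finB: "finite B" using finite_verts verts_AB by simp
  define n where "n = card B"
  obtain h where h: "bij_betw h {0..<n} B"
    using ex_bij_betw_nat_finite[OF finB] unfolding n_def by blast
  have hB: "h i \<in> B" and hV: "h i \<in> verts G" if "i < n" for i
    using h that verts_AB by (auto simp: bij_betw_def)
  have h_eq: "h i = h j \<longleftrightarrow> i = j" if "i < n" "j < n" for i j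
    using h that by (auto simp: bij_betw_def inj_on_def)
  define M where "M = mat n n (\<lambda>(a, b). int (card {w. h a \<rightarrow> w \<and> w \<rightarrow> h b}) - (if a = b then int k + int l else 0))"
  define H where "H i = mat n n (\<lambda>(a, b). half_ball (h b) (2 * i) (h a))" for i
  have M: "M \<in> carrier_mat n n" and H: "H i \<in> carrier_mat n n" for i by (simp_all add: M_def H_def)
  have M_sum: "(\<Sum>c<n. M $$ (a, c) * f (h c)) =
      (\<Sum>w | h a \<rightarrow> w. \<Sum>x | w \<rightarrow> x. f x) - (int k + int l) * f (h a)"
    if a: "a < n" for a and f :: "'a \<Rightarrow> int"
  proof -
    have "(\<Sum>c<n. M $$ (a, c) * f (h c)) = (\<Sum>c<n. int (card {w. h a \<rightarrow> w \<and> w \<rightarrow> h c}) * f (h c))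
        - (\<Sum>c<n. if a = c then (int k + int l) * f (h c) else 0)"
      using a unfolding sum_subtractf[symmetric] by (intro sum.cong refl) (simp add: M_def algebra_simps)
    also have "(\<Sum>c<n. if a = c then (int k + int l) * f (h c) else 0) = (int k + int l) * f (h a)"
      using a by simp
    also have "(\<Sum>c<n. int (card {w. h a \<rightarrow> w \<and> w \<rightarrow> h c}) * f (h c)) =
        (\<Sum>x\<in>B. int (card {w. h a \<rightarrow> w \<and> w \<rightarrow> x}) * f x)"
      using sum.reindex_bij_betw[OF h] by (simp add: atLeast0LessThan)
    finally show ?thesis unfolding adj_adj_sum[OF hB[OF a]] .
  qed
  have MH: "(M * H i) $$ (a, b) = (\<Sum>w | h a \<rightarrow> w. \<Sum>x | w \<rightarrow> x. half_ball (h b) (2 * i) x)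
      - (int k + int l) * half_ball (h b) (2 * i) (h a)" if "a < n" "b < n" for a b i
  proof -
    have "(M * H i) $$ (a, b) = (\<Sum>c<n. M $$ (a, c) * half_ball (h b) (2 * i) (h c))"
      using that M by (simp add: scalar_prod_def atLeast0LessThan H_def)
    then show ?thesis using M_sum[OF that(1)] by simp
  qed
  have half_ball_0: "half_ball u 0 v = of_bool (u = v)" if "u \<in> verts G" "v \<in> verts G" for u v
    using gdist_self gdist_eq_0D[OF conn that] that by (auto simp: half_ball_def)
  have F_H: "i \<le> r \<Longrightarrow> F_mat k l M i = H i" for i
  proof (induction i rule: induct_nat_012)
    case 0
    show ?case by (rule eq_matI) (auto simp: H_def M_def half_ball_0 hV h_eq)
  next
    case 1
    have H0: "H 0 = 1\<^sub>m n" by (rule eq_matI) (auto simp: H_def half_ball_0 hV h_eq)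
    have "M = M * H 0" using H0 M by simp
    then have "F_mat k l M (Suc 0) = M * H 0 + of_nat k \<cdot>\<^sub>m H 0" using H0 M by simp
    also have "\<dots> = H (Suc 0)"
    proof (rule eq_matI)
      fix a b assume "a < dim_row (H (Suc 0))" "b < dim_col (H (Suc 0))"
      then have ab: "a < n" "b < n" by (simp_all add: H_def)
      have "(M * H 0 + of_nat k \<cdot>\<^sub>m H 0) $$ (a, b) = (M * H 0) $$ (a, b) + int k * H 0 $$ (a, b)"
        using ab M H[of 0] by (simp del: index_mult_mat(1))
      also have "\<dots> = half_ball (h b) 2 (h a)"
        unfolding MH[OF ab] using half_ball_adj_adj_sum_0[OF hV[OF ab(2)] hB[OF ab(1)] r] ab
        by (simp add: H_def algebra_simps)
      finally show "(M * H 0 + of_nat k \<cdot>\<^sub>m H 0) $$ (a, b) = H (Suc 0) $$ (a, b)"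
        using ab by (simp add: H_def eval_nat_numeral)
    qed (simp_all add: M_def H_def)
    finally show ?case .
  next
    case (ge2 i)
    have "F_mat k l M (Suc (Suc i)) = M * H (Suc i) - (of_nat k * of_nat l) \<cdot>\<^sub>m H i"
      using ge2 by (simp del: F_mat.simps(1,2))
    also have "\<dots> = H (Suc (Suc i))"
    proof (rule eq_matI)
      fix a b assume "a < dim_row (H (Suc (Suc i)))" "b < dim_col (H (Suc (Suc i)))"
      then have ab: "a < n" "b < n" by (simp_all add: H_def)
      have "(M * H (Suc i) - (of_nat k * of_nat l) \<cdot>\<^sub>m H i) $$ (a, b) =
          (M * H (Suc i)) $$ (a, b) - int k * int l * H i $$ (a, b)"
        using ab M H[of "Suc i"] H[of i] by (simp del: index_mult_mat(1))
      also have "\<dots> = half_ball (h b) (2 * i + 4) (h a)"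
        unfolding MH[OF ab]
        using half_ball_adj_adj_sum[OF hV[OF ab(2)] hB[OF ab(1)], of "2 * i"] ab ge2(3)
        by (simp add: H_def algebra_simps)
      finally show "(M * H (Suc i) - (of_nat k * of_nat l) \<cdot>\<^sub>m H i) $$ (a, b) = H (Suc (Suc i)) $$ (a, b)"
        using ab by (simp add: H_def eval_nat_numeral)
    qed (simp_all add: M_def H_def)
    finally show ?case .
  qed
  have "F_poly k l r * [:- (1 + int k * int l), 1:] * pderiv (char_poly M) =
      of_nat n * G_poly k l r * char_poly M"
  proof (rule F_mat_char_poly[OF M])
    fix i assume "i \<le> r"
    \<comment> \<open>A half ball of even radius contains its centre, so the diagonal of
      \<open>H i\<close> is constantly 1.\<close>
    then show "mat_trace (F_mat k l M i) = int n"
      using gdist_self hV by (simp add: F_H mat_trace_def H_def half_ball_def)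
  next
    have ball: "half_ball u (2 * r) v = 1" if "u \<in> B" "v \<in> B" for u v
      using diam[OF that] gdist_parity[of u v] that verts_AB AB_disjoint by (auto simp: half_ball_def)
    \<comment> \<open>\<open>H r\<close> is the all-one matrix by \<open>ball\<close>, and the row
      sums of \<open>M\<close> are \<open>(l + 1) * (k + 1) - (k + l)\<close>.\<close>
    have "M * H r = (1 + int k * int l) \<cdot>\<^sub>m H r"
    proof (rule eq_matI)
      fix a b assume "a < dim_row ((1 + int k * int l) \<cdot>\<^sub>m H r)" "b < dim_col ((1 + int k * int l) \<cdot>\<^sub>m H r)"
      then have ab: "a < n" "b < n" by (simp_all add: H_def)
      have "(\<Sum>w | h a \<rightarrow> w. \<Sum>x | w \<rightarrow> x. half_ball (h b) (2 * r) x) =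
          (\<Sum>w | h a \<rightarrow> w. \<Sum>x | w \<rightarrow> x. 1)"
        using ball[OF hB[OF ab(2)]] adj_A[OF adj_B[OF hB[OF ab(1)]]] by (intro sum.cong refl) auto
      also have "\<dots> = (\<Sum>w | h a \<rightarrow> w. int k + 1)"
        using adj_B[OF hB[OF ab(1)]] deg_A by (intro sum.cong refl) auto
      also have "\<dots> = (int l + 1) * (int k + 1)" using deg_B[OF hB[OF ab(1)]] by simp
      finally show "(M * H r) $$ (a, b) = ((1 + int k * int l) \<cdot>\<^sub>m H r) $$ (a, b)"
        unfolding MH[OF ab] using ball[OF hB[OF ab(2)] hB[OF ab(1)]] ab by (simp add: H_def algebra_simps)
    qed (simp_all add: M_def H_def)
    then show "M * F_mat k l M r = (1 + int k * int l) \<cdot>\<^sub>m F_mat k l M r" using F_H[of r] by simp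
  qed
  moreover have "char_poly M \<noteq> 0" using degree_monic_char_poly[OF M] by auto
  ultimately show ?thesis unfolding n_def by blast
qed

section \<open>Equal valencies\<close>

lemma sum_adj_swap:
  fixes f :: "'a \<Rightarrow> int"
  assumes "\<And>v. v \<in> verts G \<Longrightarrow> card {w. v \<rightarrow> w} = d"
  shows "(\<Sum>v\<in>verts G. \<Sum>w | v \<rightarrow> w. f w) = int d * (\<Sum>v\<in>verts G. f v)"
proof -
  have e: "(\<Sum>w | v \<rightarrow> w. g w) = (\<Sum>w\<in>verts G. if v \<rightarrow> w then g w else 0)" for v and g :: "'a \<Rightarrow> int"
  proof -
    have "{w. v \<rightarrow> w} = verts G \<inter> {w. v \<rightarrow> w}" by auto
    then show ?thesis by (simp add: sum.If_cases)
  qed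
  have "(\<Sum>v\<in>verts G. \<Sum>w | v \<rightarrow> w. f w) = (\<Sum>w\<in>verts G. \<Sum>v\<in>verts G. if v \<rightarrow> w then f w else 0)"
    unfolding e by (rule sum.swap)
  also have "\<dots> = (\<Sum>w\<in>verts G. \<Sum>v | w \<rightarrow> v. f w)"
    unfolding e using adj_sym by (intro sum.cong refl) metis
  also have "\<dots> = int d * (\<Sum>v\<in>verts G. f v)"
    using assms by (simp add: sum_distrib_left)
  finally show ?thesis .
qed

text \<open>In a regular graph, summing the neighbour recurrence over all vertices gives a
  recurrence for the half-ball sizes that does not mention the centre.\<close>

lemma sum_half_ball_eq:
  assumes kl: "k = l" and r: "r \<ge> 1" and u: "u \<in> verts G" "u' \<in> verts G"
  shows "j \<le> 2 * r \<Longrightarrow> (\<Sum>v\<in>verts G. half_ball u j v) = (\<Sum>v\<in>verts G. half_ball u' j v)"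
proof -
  have deg: "card {w. v \<rightarrow> w} = k + 1" if "v \<in> verts G" for v
    using that verts_AB deg_A deg_B kl by auto
  have swap: "int (k + 1) * (\<Sum>v\<in>verts G. f v) = (\<Sum>v\<in>verts G. \<Sum>w | v \<rightarrow> w. f w)" for f
    by (rule sum_adj_swap[symmetric]) (rule deg)
  have sum_0: "(\<Sum>v\<in>verts G. half_ball u 0 v) = 1" if u: "u \<in> verts G" for u
  proof -
    have "half_ball u 0 v = (if v = u then 1 else 0)" if "v \<in> verts G" for v
      using gdist_self gdist_eq_0D[OF conn] that u by (auto simp: half_ball_def)
    then show ?thesis using u by simp
  qed
  show "j \<le> 2 * r \<Longrightarrow> (\<Sum>v\<in>verts G. half_ball u j v) = (\<Sum>v\<in>verts G. half_ball u' j v)"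
  proof (induction j rule: induct_nat_012)
    case 0
    show ?case using sum_0 u by simp
  next
    case 1
    have "(\<Sum>v\<in>verts G. half_ball u (Suc 0) v) = int (k + 1) * (\<Sum>v\<in>verts G. half_ball u 0 v)"
      if "u \<in> verts G" for u
      unfolding swap using half_ball_adj_sum_0[OF that _ r]
      by (intro sum.cong) auto
    then show ?case using u sum_0 by simp
  next
    case (ge2 j)
    have "int (k + 1) * (\<Sum>v\<in>verts G. half_ball u (Suc j) v) =
        (\<Sum>v\<in>verts G. half_ball u (Suc (Suc j)) v) + int k * (\<Sum>v\<in>verts G. half_ball u j v)"
      if "u \<in> verts G" for u
    proof -
      have "int (k + 1) * (\<Sum>v\<in>verts G. half_ball u (Suc j) v) =
          (\<Sum>v\<in>verts G. half_ball u (Suc (Suc j)) v + int k * half_ball u j v)"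
        unfolding swap using half_ball_adj_sum[OF that, of _ j] ge2(3) deg by (intro sum.cong) auto
      then show ?thesis by (simp only: sum.distrib sum_distrib_left)
    qed
    from this[OF u(1)] this[OF u(2)] show ?case using ge2 by simp
  qed
qed

text \<open>
  For \<open>k = l\<close> the half balls of radius \<open>2 * r\<close> have the same size around all vertices. Around a vertex
  of \<open>B\<close> it is all of \<open>B\<close>, and \<open>card A = card B\<close>.
\<close>

lemma equal_valencies_gdist_le:
  assumes kl: "k = l" and r: "r \<ge> 1" and diam: "\<And>u v. u \<in> B \<Longrightarrow> v \<in> B \<Longrightarrow> gdist G u v \<le> 2 * r"
    and uv: "u \<in> A" "v \<in> A"
  shows "gdist G u v \<le> 2 * r"
proof -
  have fin: "finite A" "finite B" using finite_verts verts_AB by (metis finite_Un)+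
  have "card {w. u \<rightarrow> w} > 0" using deg_A[OF uv(1)] by simp
  then obtain b where "u \<rightarrow> b" by (metis (no_types, lifting) card_gt_0_iff ex_in_conv mem_Collect_eq)
  then have b: "b \<in> B" using adj_A uv(1) by blast
  have val: "half_ball x (2 * r) y = of_bool (gdist G x y \<le> 2 * r \<and> (x \<in> A \<longleftrightarrow> y \<in> A))"
    if "x \<in> verts G" "y \<in> verts G" for x y
    using gdist_parity[OF that] by (simp add: half_ball_def)
  have "(\<Sum>y\<in>verts G. half_ball b (2 * r) y) = (\<Sum>y\<in>verts G. of_bool (y \<in> B))"
    using b diam[OF b] verts_AB AB_disjoint by (intro sum.cong refl) (auto simp: val)
  also have "\<dots> = int (card B)"
    using verts_AB fin by (simp add: of_bool_def sum.If_cases Int_absorb1 flip: Int_def)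
  finally have sB: "(\<Sum>y\<in>verts G. half_ball b (2 * r) y) = int (card B)" .
  have "(\<Sum>y\<in>verts G. half_ball u (2 * r) y) = (\<Sum>y\<in>verts G. of_bool (y \<in> A \<and> gdist G u y \<le> 2 * r))"
    using uv verts_AB by (intro sum.cong refl) (auto simp: val)
  also have "\<dots> = int (card {y \<in> A. gdist G u y \<le> 2 * r})"
  proof -
    have "verts G \<inter> {y \<in> A. gdist G u y \<le> 2 * r} = {y \<in> A. gdist G u y \<le> 2 * r}" using verts_AB by auto
    then show ?thesis by (simp add: of_bool_def sum.If_cases)
  qed
  finally have "card {y \<in> A. gdist G u y \<le> 2 * r} = card B"
    using sB sum_half_ball_eq[OF kl r, of u b "2 * r"] uv(1) b verts_AB by simp
  also have "\<dots> = card A"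
  proof -
    \<comment> \<open>The edges are counted from both classes.\<close>
    have "(\<Sum>a\<in>A. card {b\<in>B. a \<rightarrow> b}) = (\<Sum>b\<in>B. card {a\<in>A. a \<rightarrow> b})"
      using fin by (intro sum_multicount_gen) auto
    moreover have "{b\<in>B. a \<rightarrow> b} = {b. a \<rightarrow> b}" if "a \<in> A" for a using adj_A that by blast
    moreover have "{a\<in>A. a \<rightarrow> b} = {a. b \<rightarrow> a}" if "b \<in> B" for b using adj_B that adj_sym by blast
    ultimately have "card A * (k + 1) = card B * (l + 1)" using deg_A deg_B by simp
    then show ?thesis unfolding kl by (simp only: mult_cancel2) simp
  qed
  finally have "{y \<in> A. gdist G u y \<le> 2 * r} = A" using fin by (intro card_subset_eq) auto
  then show ?thesis using uv(2) by blast
qed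

end

section \<open>From distance-biregular graphs to the matrix argument\<close>

theorem corollary5p9:
  fixes G :: "('a, 'b) pre_digraph" and A B :: "'a set" and k l r :: nat
  assumes "distance_biregular G A B"
    and "unbalanced G A B"
    and "girth_deficiency_two G"
    and "class_ecc G B < class_ecc G A"
    and "diameter G = 2 * r + 2" and "r \<ge> 1"
    and "\<forall>u \<in> A. out_degree G u = k + 1"
    and "\<forall>u \<in> B. out_degree G u = l + 1"
  shows "\<forall>p :: int poly. irreducible p \<and> p dvd F_poly k l r \<longrightarrow> degree p \<le> 2"
proof -
  from assms(1) interpret graph G by (simp add: distance_biregular_def)
  have conn: "connected G" and bip: "bipartition G A B"
    using assms(1) by (simp_all add: distance_biregular_def)
  have girth: "girth G = enat (4 * r + 2)"
    using assms(3,5) by (simp add: girth_deficiency_two_def)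
  interpret biregular_graph G A B k l r
  proof
    fix p assume p: "cycle p" "3 \<le> length p"
    then have "girth G \<le> enat (length p)" unfolding girth_def by (intro INF_lower) simp
    then show "4 * r < length p" unfolding girth by simp
  qed (use conn bip assms(7,8) out_degree_card_nbrs in auto)
  have ecc_A: "ecc G u = class_ecc G A" if "u \<in> A" for u
    using distance_biregular_ecc[OF assms(1) _ that] by simp
  have ecc_B: "ecc G u = class_ecc G B" if "u \<in> B" for u
    using distance_biregular_ecc[OF assms(1) _ that] by simp
  have "verts G \<noteq> {}" using conn by (auto simp: connected_def strongly_connected_def)
  then have "diameter G \<in> ecc G ` verts G" unfolding diameter_def by (intro Max_in) auto
  then obtain u where u: "u \<in> verts G" "ecc G u = 2 * r + 2" using assms(5) by auto
  have u_le: "ecc G w \<le> 2 * r + 2" if "w \<in> verts G" for w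
    unfolding assms(5)[symmetric] diameter_def using that by (intro Max_ge) auto
  \<comment> \<open>The diameter is attained in \<open>A\<close>: a vertex of \<open>B\<close>
    attaining it would have a neighbour in \<open>A\<close> of larger eccentricity.\<close>
  obtain a where a: "a \<in> A" "ecc G a = 2 * r + 2"
  proof -
    consider "u \<in> A" | "u \<in> B" using u(1) verts_AB by blast
    then show ?thesis
    proof cases
      case 1
      then show ?thesis using that u(2) by blast
    next
      case 2
      then obtain w where "u \<rightarrow>\<^bsub>G\<^esub> w" using deg_B[of u]
        by (metis (no_types, lifting) Suc_eq_plus1 card.empty empty_Collect_eq nat.distinct(1))
      then have w: "w \<in> A" using adj_B 2 by blast
      then have "ecc G u < ecc G w" using assms(4) ecc_A ecc_B 2 by simp
      then show ?thesis using u_le[of w] w verts_AB u(2) by simp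
    qed
  qed
  obtain v where v: "v \<in> verts G" "gdist G a v = 2 * r + 2"
    using ecc_attained[of a] a verts_AB by auto
  then have vA: "v \<in> A" using gdist_parity[of a v] a(1) verts_AB by simp
  obtain b where "a \<rightarrow>\<^bsub>G\<^esub> b" using deg_A[OF a(1)]
    by (metis (no_types, lifting) Suc_eq_plus1 card.empty empty_Collect_eq nat.distinct(1))
  then have b: "b \<in> B" using adj_A a(1) by blast
  \<comment> \<open>Eccentricities in \<open>B\<close> are at most \<open>2 * r + 1\<close>, and
    distances within \<open>B\<close> are even.\<close>
  have diam: "gdist G x y \<le> 2 * r" if "x \<in> B" "y \<in> B" for x y
  proof -
    have "gdist G x y \<le> ecc G x" using that verts_AB by (intro gdist_le_ecc) auto
    also have "\<dots> < 2 * r + 2" using assms(4) ecc_A[OF a(1)] ecc_B[OF that(1)] a(2) by simp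
    finally have "gdist G x y < 2 * r + 2" .
    moreover have "even (gdist G x y)" using gdist_parity[of x y] that verts_AB AB_disjoint by auto
    ultimately show ?thesis by presburger
  qed
  \<comment> \<open>Equal valencies would force \<open>gdist G a v \<le> 2 * r\<close>, but this
    distance is \<open>2 * r + 2\<close>.\<close>
  have "k \<noteq> l" using equal_valencies_gdist_le[OF _ assms(6) diam a(1) vA] v(2) by auto
  then have kl: "k * l \<noteq> 1" by auto
  have "card B > 0" using b finite_verts verts_AB by (auto simp: card_gt_0_iff)
  moreover obtain \<chi> where "\<chi> \<noteq> 0"
    "F_poly k l r * [:- (1 + int k * int l), 1:] * pderiv \<chi> = of_nat (card B) * G_poly k l r * \<chi>"
    using char_poly_identity[OF assms(6) diam] by blast
  ultimately show ?thesis using degree_irreducible_factor_F_poly kl by blast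
qed

end
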